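(* Let $K\subset\mathbb R^N$ be a finitely arcwise connected nested fractal, with its discrete spectral triple $(\mathcal A,\mathcal H,D)$. The (a priori possibly infinite) distance on $K$ induced by the seminorm $L_{\mathrm{ess}}$, $$d_{\mathrm{ess}}(x,y)=\sup\{|f(x)-f(y)|:f\in\mathcal A,\ L_{\mathrm{ess}}(f)\le1\},\qquad x,y\in K,$$ is finite and coincides with the Euclidean geodesic distance $d_{\mathrm{geo}}$ on $K$.
   Context: Nested fractals. Let $w_1,\dots,w_k:\mathbb R^N\to\mathbb R^N$ be contracting similarities, $\|w_i(x)-w_i(y)\|=\lambda_i\|x-y\|$ with $\lambda_i\in(0,1)$, and let $K$ be the unique non-empty compact set with $K=\bigcup_{i=1}^k w_i(K)$. Let $p_i$ be the fixed point of $w_i$; $p_i$ is an essential fixed point if there are $i',j,j'\in\{1,\dots,k\}$ with $i'\ne i$ and $w_j(p_i)=w_{j'}(p_{i'})$. $V_0$ is the set of essential fixed points (assumed to have at least two elements) and $E_0=\{(p,q):p,q\in V_0,\ p\neq q\}$ is the set of oriented edges; for $e=(p,q)$ write $e^+=p$, $e^-=q$, and $\ell(e)=\|e^+-e^-\|$ for its length. $\Sigma_n$ is the set of maps $\sigma:\{1,\dots,n\}\to\{1,\dots,k\}$, $w_\sigma=w_{\sigma(1)}\circ\cdots\circ w_{\sigma(n)}$, $|\sigma|=n$; $\Sigma_0=\{\emptyset\}$, $w_\emptyset=\mathrm{id}$, $\Sigma=\bigcup_{n\ge0}\Sigma_n$. $V_n=\bigcup_{\sigma\in\Sigma_n}w_\sigma(V_0)$,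 $E_n=\{(w_\sigma(p),w_\sigma(q)):\sigma\in\Sigma_n,\ (p,q)\in E_0\}$. Sets $w_\sigma(V_0)$, $\sigma\in\Sigma_n$, are combinatorial $n$-cells. $K$ (with its maps) is a nested fractal if: (1) $\lambda_i=\lambda$ for all $i$; (2) there is a (non-empty) bounded open set $U\subset\mathbb R^N$ with $\bigcup_i w_i(U)\subset U$ and $w_i(U)\cap w_j(U)=\emptyset$ for $i\neq j$; (3) the graph $(V_1,E_1)$ is connected; (4) for all $n$ and $\sigma\neq\sigma'$ in $\Sigma_n$, $w_\sigma(V_0)\neq w_{\sigma'}(V_0)$ and $w_\sigma(K)\cap w_{\sigma'}(K)=w_\sigma(V_0)\cap w_{\sigma'}(V_0)$; (5) for $p\neq q$ in $V_0$, the reflection in the hyperplane $\Pi_{pq}=\{z:\|z-p\|=\|z-q\|\}$ maps combinatorial $n$-cells to combinatorial $n$-cells for all $n\ge0$, and maps any combinatorial $n$-cell lying on both sides of $\Pi_{pq}$ to itself. Discrete spectral triple. $\mathcal H$ is the Hilbert space with orthonormal basis $\{\delta_{\sigma,e}:\sigma\in\Sigma,\ e\in E_0\}$. A function $f\in C(K)$ acts by $f\,\delta_{\sigma,e}=f(w_\sigma(e^+))\,\delta_{\sigma,e}$, and $D$ is the self-adjoint operator with $D\,\delta_{\sigma,e}=\lambda^{-|\sigma|}\ell(e)^{-1}\delta_{\sigma,\bar e}$, where $\bar e=(e^-,e^+)$. $\mathcal A=\{f\in C(K):[D,f]\text{ is bounded}\}$. $L_{\mathrm{ess}}(f)=\|p([D,f])\|$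 for $f\in\mathcal A$, where $p:\mathcal B(\mathcal H)\to\mathcal B(\mathcal H)/\mathcal K(\mathcal H)$ is the quotient map to the Calkin algebra (i.e. $L_{\mathrm{ess}}(f)$ is the essential norm of $[D,f]$). $K$ is finitely arcwise connected if any two points of $K$ can be joined by a rectifiable curve in $K$; then the Euclidean geodesic distance is $d_{\mathrm{geo}}(x,y)=\inf\{\ell(\gamma):\gamma:[0,1]\to K\text{ rectifiable},\ \gamma(0)=x,\ \gamma(1)=y\}$, with $\ell(\gamma)$ the Euclidean length. *)

theory Defs
  imports "HOL-Analysis.Analysis"
begin

section \<open>The Hilbert space of square-summable families\<close>

definition square_summable :: "('i \<Rightarrow> complex) \<Rightarrow> bool" where
  "square_summable x \<longleftrightarrow> (\<lambda>i. (cmod (x i))\<^sup>2) summable_on UNIV"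

lemma square_summable_zero: "square_summable (\<lambda>_. 0)"
  by (simp add: square_summable_def)

lemma square_summable_scale:
  assumes "square_summable x" shows "square_summable (\<lambda>i. c * x i)"
  using summable_on_cmult_right[of "\<lambda>i. (cmod (x i))\<^sup>2" UNIV "(cmod c)\<^sup>2"] assms
  by (simp add: square_summable_def norm_mult power_mult_distrib)

lemma square_summable_add:
  assumes "square_summable x" "square_summable y"
  shows "square_summable (\<lambda>i. x i + y i)"
proof -
  have s: "(\<lambda>i. 2 * (cmod (x i))\<^sup>2 + 2 * (cmod (y i))\<^sup>2) summable_on UNIV"
    using assms unfolding square_summable_def
    by (intro summable_on_add summable_on_cmult_right)
  have "(cmod (x i + y i))\<^sup>2 \<le> 2 * (cmod (x i))\<^sup>2 + 2 * (cmod (y i))\<^sup>2" for i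
  proof -
    have "(cmod (x i + y i))\<^sup>2 \<le> (cmod (x i) + cmod (y i))\<^sup>2"
      by (intro power_mono norm_triangle_ineq) auto
    also have "\<dots> \<le> 2 * (cmod (x i))\<^sup>2 + 2 * (cmod (y i))\<^sup>2"
      using sum_squares_bound[of "cmod (x i)" "cmod (y i)"] by (simp add: power2_sum)
    finally show ?thesis .
  qed
  then show ?thesis
    unfolding square_summable_def by (intro summable_on_comparison_test[OF s]) auto
qed

lemma square_summable_uminus:
  "square_summable x \<Longrightarrow> square_summable (\<lambda>i. - x i)"
  using square_summable_scale[of x "-1"] by simp

lemma square_summable_diff:
  "square_summable x \<Longrightarrow> square_summable y \<Longrightarrow> square_summable (\<lambda>i. x i - y i)"
  using square_summable_add[of x "\<lambda>i. - y i"] by (simp add: square_summable_uminus)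

lemma square_summable_inner:
  assumes "square_summable x" "square_summable y"
  shows "(\<lambda>i. x i \<bullet> y i) summable_on UNIV"
proof -
  have s: "(\<lambda>i. (cmod (x i))\<^sup>2 + (cmod (y i))\<^sup>2) summable_on UNIV"
    using assms unfolding square_summable_def by (intro summable_on_add)
  have "norm (x i \<bullet> y i) \<le> (cmod (x i))\<^sup>2 + (cmod (y i))\<^sup>2" for i
  proof -
    have "norm (x i \<bullet> y i) \<le> cmod (x i) * cmod (y i)"
      using Cauchy_Schwarz_ineq2[of "x i" "y i"] by simp
    moreover have "0 \<le> cmod (x i) * cmod (y i)" by simp
    moreover have "2 * (cmod (x i) * cmod (y i)) \<le> (cmod (x i))\<^sup>2 + (cmod (y i))\<^sup>2"
      using sum_squares_bound[of "cmod (x i)" "cmod (y i)"] by (simp add: mult.assoc)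
    ultimately show ?thesis by linarith
  qed
  then have "(\<lambda>i. norm (x i \<bullet> y i)) summable_on UNIV"
    by (intro summable_on_comparison_test[OF s]) auto
  then show ?thesis
    by (rule abs_summable_summable)
qed

typedef 'i ell2 = "{x :: 'i \<Rightarrow> complex. square_summable x}"
  morphisms coord Abs_ell2
  using square_summable_zero by blast

setup_lifting type_definition_ell2

lemma square_summable_coord: "square_summable (coord x)"
  using coord[of x] by simp

lift_definition scale_ell2 :: "complex \<Rightarrow> 'i ell2 \<Rightarrow> 'i ell2" is "\<lambda>c x i. c * x i"
  by (rule square_summable_scale)

text \<open>The real inner product below is the real part of
  \<open>\<langle>x, y\<rangle> = (\<Sum>i. x i * cnj (y i))\<close>, so it induces the usual norm.\<close>

instantiation ell2 :: (type) real_inner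
begin

lift_definition zero_ell2 :: "'a ell2" is "\<lambda>_. 0"
  by (rule square_summable_zero)

lift_definition plus_ell2 :: "'a ell2 \<Rightarrow> 'a ell2 \<Rightarrow> 'a ell2" is "\<lambda>x y i. x i + y i"
  by (rule square_summable_add)

lift_definition minus_ell2 :: "'a ell2 \<Rightarrow> 'a ell2 \<Rightarrow> 'a ell2" is "\<lambda>x y i. x i - y i"
  by (rule square_summable_diff)

lift_definition uminus_ell2 :: "'a ell2 \<Rightarrow> 'a ell2" is "\<lambda>x i. - x i"
  by (rule square_summable_uminus)

definition scaleR_ell2 :: "real \<Rightarrow> 'a ell2 \<Rightarrow> 'a ell2" where
  "scaleR_ell2 r x = scale_ell2 (of_real r) x"

definition inner_ell2 :: "'a ell2 \<Rightarrow> 'a ell2 \<Rightarrow> real" where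
  "inner_ell2 x y = (\<Sum>\<^sub>\<infinity>i. coord x i \<bullet> coord y i)"

definition norm_ell2 :: "'a ell2 \<Rightarrow> real" where
  "norm_ell2 x = sqrt (inner x x)"

definition dist_ell2 :: "'a ell2 \<Rightarrow> 'a ell2 \<Rightarrow> real" where
  "dist_ell2 x y = norm (x - y)"

definition sgn_ell2 :: "'a ell2 \<Rightarrow> 'a ell2" where
  "sgn_ell2 x = inverse (norm x) *\<^sub>R x"

definition uniformity_ell2 :: "('a ell2 \<times> 'a ell2) filter" where
  "uniformity_ell2 = (INF e\<in>{0<..}. principal {(x, y). dist x y < e})"

definition open_ell2 :: "'a ell2 set \<Rightarrow> bool" where
  "open_ell2 U \<longleftrightarrow> (\<forall>x\<in>U. eventually (\<lambda>(x', y). x' = x \<longrightarrow> y \<in> U) uniformity)"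

instance
proof
  fix x y z :: "'a ell2" and r s :: real and U :: "'a ell2 set"
  note sm = square_summable_inner[OF square_summable_coord square_summable_coord]
  show "x + y + z = x + (y + z)" by transfer (simp add: algebra_simps)
  show "x + y = y + x" by transfer (simp add: algebra_simps)
  show "0 + x = x" by transfer simp
  show "- x + x = 0" by transfer simp
  show "x - y = x + - y" by transfer simp
  show "r *\<^sub>R (x + y) = r *\<^sub>R x + r *\<^sub>R y"
    unfolding scaleR_ell2_def by transfer (simp add: algebra_simps)
  show "(r + s) *\<^sub>R x = r *\<^sub>R x + s *\<^sub>R x"
    unfolding scaleR_ell2_def by transfer (simp add: algebra_simps)
  show "r *\<^sub>R s *\<^sub>R x = (r * s) *\<^sub>R x"
    unfolding scaleR_ell2_def by transfer (simp add: algebra_simps)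
  show "1 *\<^sub>R x = x"
    unfolding scaleR_ell2_def by transfer simp
  show "dist x y = norm (x - y)" by (rule dist_ell2_def)
  show "sgn x = inverse (norm x) *\<^sub>R x" by (rule sgn_ell2_def)
  show "uniformity = (INF e\<in>{0<..}. principal {(x::'a ell2, y). dist x y < e})"
    by (rule uniformity_ell2_def)
  show "open U \<longleftrightarrow> (\<forall>x\<in>U. eventually (\<lambda>(x', y). x' = x \<longrightarrow> y \<in> U) uniformity)"
    by (rule open_ell2_def)
  show "norm x = sqrt (x \<bullet> x)" by (rule norm_ell2_def)
  show "x \<bullet> y = y \<bullet> x" by (simp add: inner_ell2_def inner_commute)
  show "(x + y) \<bullet> z = x \<bullet> z + y \<bullet> z"
    unfolding inner_ell2_def plus_ell2.rep_eq inner_add_left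
    by (rule infsum_add[OF sm sm])
  show "(r *\<^sub>R x) \<bullet> y = r * (x \<bullet> y)"
  proof -
    have "coord (r *\<^sub>R x) i \<bullet> coord y i = r * (coord x i \<bullet> coord y i)" for i
      by (simp add: scaleR_ell2_def scale_ell2.rep_eq scaleR_conv_of_real[symmetric])
    then show ?thesis
      unfolding inner_ell2_def by (simp add: infsum_cmult_right')
  qed
  show "0 \<le> x \<bullet> x"
    unfolding inner_ell2_def by (intro infsum_nonneg) auto
  show "x \<bullet> x = 0 \<longleftrightarrow> x = 0"
  proof
    assume "x \<bullet> x = 0"
    then have "coord x i \<bullet> coord x i = 0" for i
      unfolding inner_ell2_def
      by (intro nonneg_infsum_le_0D[OF _ sm]) auto
    then show "x = 0" by (simp add: coord_inject[symmetric] zero_ell2.rep_eq fun_eq_iff)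
  qed (simp add: inner_ell2_def zero_ell2.rep_eq)
qed

end

lemma norm_ell2_power2: "(norm x)\<^sup>2 = (\<Sum>\<^sub>\<infinity>i. (cmod (coord x i))\<^sup>2)"
  by (simp add: power2_norm_eq_inner inner_ell2_def)

lemma sum_coord_le_norm:
  assumes "finite F" shows "(\<Sum>i\<in>F. (cmod (coord x i))\<^sup>2) \<le> (norm x)\<^sup>2"
  unfolding norm_ell2_power2 using square_summable_coord[of x] assms
  by (intro finite_sum_le_infsum) (auto simp: square_summable_def)

lemma cmod_coord_le_norm: "cmod (coord x i) \<le> norm x"
  using sum_coord_le_norm[of "{i}" x] by (simp add: power2_le_iff_abs_le)

instance ell2 :: (type) banach
proof
  fix X :: "nat \<Rightarrow> 'a ell2"
  assume X: "Cauchy X"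
  have "Cauchy (\<lambda>n. coord (X n) i)" for i
  proof (rule metric_CauchyI)
    fix e :: real assume "e > 0"
    then obtain M where "\<forall>m\<ge>M. \<forall>n\<ge>M. dist (X m) (X n) < e"
      using X unfolding Cauchy_def by blast
    moreover have "dist (coord (X m) i) (coord (X n) i) \<le> dist (X m) (X n)" for m n
      using cmod_coord_le_norm[of "X m - X n" i] by (simp add: dist_norm minus_ell2.rep_eq)
    ultimately show "\<exists>M. \<forall>m\<ge>M. \<forall>n\<ge>M. dist (coord (X m) i) (coord (X n) i) < e"
      by (meson le_less_trans)
  qed
  then have "\<forall>i. \<exists>l. (\<lambda>n. coord (X n) i) \<longlonglongrightarrow> l"
    by (metis Cauchy_convergent_iff convergent_def)
  then obtain l where l: "\<And>i. (\<lambda>n. coord (X n) i) \<longlonglongrightarrow> l i"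
    by metis
  have fin: "(\<Sum>i\<in>F. (cmod (coord (X n) i - l i))\<^sup>2) \<le> e\<^sup>2"
    if "finite F" "e > 0" "\<forall>m\<ge>M. \<forall>n\<ge>M. dist (X m) (X n) < e" "n \<ge> M" for F e M n
  proof (rule tendsto_upperbound)
    show "(\<lambda>m. \<Sum>i\<in>F. (cmod (coord (X n) i - coord (X m) i))\<^sup>2)
        \<longlonglongrightarrow> (\<Sum>i\<in>F. (cmod (coord (X n) i - l i))\<^sup>2)"
      by (intro tendsto_intros l)
    have "(\<Sum>i\<in>F. (cmod (coord (X n) i - coord (X m) i))\<^sup>2) \<le> e\<^sup>2" if "m \<ge> M" for m
    proof -
      have "(\<Sum>i\<in>F. (cmod (coord (X n) i - coord (X m) i))\<^sup>2) \<le> (norm (X n - X m))\<^sup>2"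
        using sum_coord_le_norm[OF \<open>finite F\<close>, of "X n - X m"] by (simp add: minus_ell2.rep_eq)
      also have "\<dots> \<le> e\<^sup>2"
        using that \<open>n \<ge> M\<close> \<open>\<forall>m\<ge>M. \<forall>n\<ge>M. dist (X m) (X n) < e\<close>
        by (intro power_mono) (auto simp: dist_norm intro: less_imp_le)
      finally show ?thesis .
    qed
    then show "\<forall>\<^sub>F m in sequentially. (\<Sum>i\<in>F. (cmod (coord (X n) i - coord (X m) i))\<^sup>2) \<le> e\<^sup>2"
      by (auto simp: eventually_sequentially)
  qed simp
  have sq: "square_summable (\<lambda>i. coord (X n) i - l i)"
    if "e > 0" "\<forall>m\<ge>M. \<forall>n\<ge>M. dist (X m) (X n) < e" "n \<ge> M" for e M n
    unfolding square_summable_def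
    by (rule nonneg_bdd_above_summable_on)
       (auto intro!: bdd_aboveI2[where M = "e\<^sup>2"] fin[OF _ that])
  have "square_summable l"
  proof -
    obtain M where M: "\<forall>m\<ge>M. \<forall>n\<ge>M. dist (X m) (X n) < 1"
      using X unfolding Cauchy_def by (metis zero_less_one)
    show ?thesis
      using square_summable_diff[OF square_summable_coord sq[OF _ M order_refl], of "X M"] by simp
  qed
  then have L: "coord (Abs_ell2 l) = l"
    by (simp add: Abs_ell2_inverse)
  have "X \<longlonglongrightarrow> Abs_ell2 l"
  proof (rule metric_LIMSEQ_I)
    fix e :: real assume e: "e > 0"
    then obtain M where M: "\<forall>m\<ge>M. \<forall>n\<ge>M. dist (X m) (X n) < e / 2"
      using X unfolding Cauchy_def by (metis half_gt_zero)
    have "dist (X n) (Abs_ell2 l) < e" if "n \<ge> M" for n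
    proof -
      have "(norm (X n - Abs_ell2 l))\<^sup>2 \<le> (e / 2)\<^sup>2"
        unfolding norm_ell2_power2 minus_ell2.rep_eq L
        using sq[OF _ M that] e fin[OF _ _ M that]
        by (intro infsum_le_finite_sums) (auto simp: square_summable_def)
      then have "norm (X n - Abs_ell2 l) \<le> e / 2"
        using e by (simp add: power2_le_iff_abs_le)
      then show ?thesis using e by (simp add: dist_norm)
    qed
    then show "\<exists>M. \<forall>n\<ge>M. dist (X n) (Abs_ell2 l) < e" by blast
  qed
  then show "convergent X" by (auto simp: convergent_def)
qed

text \<open>The index set of the orthonormal basis depends on the fractal, hence
  \<open>\<ell>\<^sup>2(I)\<close> is taken as a closed subspace of \<open>\<ell>\<^sup>2\<close> over the whole index type.
  Operators on it are functions extensional off that subspace, so that they are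
  determined by their values on it.\<close>

definition ell2_on :: "'i set \<Rightarrow> 'i ell2 set" where
  "ell2_on I = {x. \<forall>i. i \<notin> I \<longrightarrow> coord x i = 0}"

definition bounded_ops :: "'i ell2 set \<Rightarrow> ('i ell2 \<Rightarrow> 'i ell2) set" where
  "bounded_ops H = {T \<in> H \<rightarrow>\<^sub>E H.
     (\<forall>x\<in>H. \<forall>y\<in>H. T (x + y) = T x + T y) \<and>
     (\<forall>c. \<forall>x\<in>H. T (scale_ell2 c x) = scale_ell2 c (T x)) \<and>
     (\<exists>B. \<forall>x\<in>H. norm (T x) \<le> B * norm x)}"

definition compact_ops :: "'i ell2 set \<Rightarrow> ('i ell2 \<Rightarrow> 'i ell2) set" where
  "compact_ops H = {T \<in> bounded_ops H. compact (closure (T ` (H \<inter> cball 0 1)))}"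

definition op_norm :: "'i ell2 set \<Rightarrow> ('i ell2 \<Rightarrow> 'i ell2) \<Rightarrow> real" where
  "op_norm H T = (SUP x\<in>H \<inter> cball 0 1. norm (T x))"

text \<open>The quotient norm of the class of \<open>T\<close> in the Calkin algebra.\<close>

definition ess_norm :: "'i ell2 set \<Rightarrow> ('i ell2 \<Rightarrow> 'i ell2) \<Rightarrow> real" where
  "ess_norm H T = (INF C\<in>compact_ops H. op_norm H (\<lambda>x. T x - C x))"


section \<open>Nested fractals\<close>

text \<open>The maps are \<open>w i\<close> for \<open>i\<close> in a finite index type \<open>'k\<close>, and words
  \<open>\<sigma> \<in> \<Sigma>\<^sub>n\<close> are lists over \<open>'k\<close> of length \<open>n\<close>; all words are \<open>UNIV\<close>.\<close>

definition contracting_similarity :: "real \<Rightarrow> ('a::metric_space \<Rightarrow> 'a) \<Rightarrow> bool" where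
  "contracting_similarity c f \<longleftrightarrow> 0 < c \<and> c < 1 \<and> (\<forall>x y. dist (f x) (f y) = c * dist x y)"

definition fixed_point :: "('a \<Rightarrow> 'a) \<Rightarrow> 'a" where
  "fixed_point f = (THE p. f p = p)"

definition ess_fixed_points :: "('k \<Rightarrow> 'a \<Rightarrow> 'a) \<Rightarrow> 'a set" where
  "ess_fixed_points w = {fixed_point (w i) | i.
     \<exists>i' j j'. i' \<noteq> i \<and> w j (fixed_point (w i)) = w j' (fixed_point (w i'))}"

definition edges0 :: "('k \<Rightarrow> 'a \<Rightarrow> 'a) \<Rightarrow> ('a \<times> 'a) set" where
  "edges0 w = {(p, q). p \<in> ess_fixed_points w \<and> q \<in> ess_fixed_points w \<and> p \<noteq> q}"

definition edge_length :: "'a::metric_space \<times> 'a \<Rightarrow> real" where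
  "edge_length e = dist (fst e) (snd e)"

primrec word_map :: "('k \<Rightarrow> 'a \<Rightarrow> 'a) \<Rightarrow> 'k list \<Rightarrow> 'a \<Rightarrow> 'a" where
  "word_map w [] = id"
| "word_map w (i # \<sigma>) = w i \<circ> word_map w \<sigma>"

definition words :: "nat \<Rightarrow> 'k list set" where
  "words n = {\<sigma>. length \<sigma> = n}"

definition vertices :: "('k \<Rightarrow> 'a \<Rightarrow> 'a) \<Rightarrow> nat \<Rightarrow> 'a set" where
  "vertices w n = (\<Union>\<sigma>\<in>words n. word_map w \<sigma> ` ess_fixed_points w)"

definition edges :: "('k \<Rightarrow> 'a \<Rightarrow> 'a) \<Rightarrow> nat \<Rightarrow> ('a \<times> 'a) set" where
  "edges w n = {(word_map w \<sigma> p, word_map w \<sigma> q) | \<sigma> p q. \<sigma> \<in> words n \<and> (p, q) \<in> edges0 w}"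

definition cells :: "('k \<Rightarrow> 'a \<Rightarrow> 'a) \<Rightarrow> nat \<Rightarrow> 'a set set" where
  "cells w n = (\<lambda>\<sigma>. word_map w \<sigma> ` ess_fixed_points w) ` words n"

text \<open>For \<open>p \<noteq> q\<close>, the reflection in the hyperplane of points equidistant from \<open>p\<close> and \<open>q\<close>,
  which passes through the midpoint of \<open>p\<close> and \<open>q\<close> and is orthogonal to \<open>p - q\<close>.\<close>

definition bisector_reflection :: "'a::real_inner \<Rightarrow> 'a \<Rightarrow> 'a \<Rightarrow> 'a" where
  "bisector_reflection p q z =
     z - (2 * ((z - midpoint p q) \<bullet> (p - q)) / ((p - q) \<bullet> (p - q))) *\<^sub>R (p - q)"

definition on_both_sides :: "'a::metric_space \<Rightarrow> 'a \<Rightarrow> 'a set \<Rightarrow> bool" where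
  "on_both_sides p q C \<longleftrightarrow> (\<exists>x\<in>C. dist x p < dist x q) \<and> (\<exists>y\<in>C. dist y q < dist y p)"

definition nested_fractal ::
  "('k::finite \<Rightarrow> 'a::euclidean_space \<Rightarrow> 'a) \<Rightarrow> real \<Rightarrow> 'a set \<Rightarrow> bool" where
  "nested_fractal w lam K \<longleftrightarrow>
     (\<forall>i. contracting_similarity lam (w i)) \<and>
     K \<noteq> {} \<and> compact K \<and> K = (\<Union>i. w i ` K) \<and>
     (\<exists>p\<in>ess_fixed_points w. \<exists>q\<in>ess_fixed_points w. p \<noteq> q) \<and>
     (\<exists>U. U \<noteq> {} \<and> bounded U \<and> open U \<and> (\<Union>i. w i ` U) \<subseteq> U \<and>
        (\<forall>i j. i \<noteq> j \<longrightarrow> w i ` U \<inter> w j ` U = {})) \<and>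
     (\<forall>x\<in>vertices w 1. \<forall>y\<in>vertices w 1. (x, y) \<in> (edges w 1)\<^sup>*) \<and>
     (\<forall>n. \<forall>\<sigma>\<in>words n. \<forall>\<sigma>'\<in>words n. \<sigma> \<noteq> \<sigma>' \<longrightarrow>
        word_map w \<sigma> ` ess_fixed_points w \<noteq> word_map w \<sigma>' ` ess_fixed_points w \<and>
        word_map w \<sigma> ` K \<inter> word_map w \<sigma>' ` K =
          word_map w \<sigma> ` ess_fixed_points w \<inter> word_map w \<sigma>' ` ess_fixed_points w) \<and>
     (\<forall>p\<in>ess_fixed_points w. \<forall>q\<in>ess_fixed_points w. p \<noteq> q \<longrightarrow>
        (\<forall>n. \<forall>C\<in>cells w n. bisector_reflection p q ` C \<in> cells w n \<and>
           (on_both_sides p q C \<longrightarrow> bisector_reflection p q ` C = C)))"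


section \<open>The geodesic distance\<close>

text \<open>Supremum over finite chains \<open>0 \<le> t 0 \<le> \<dots> \<le> t n \<le> 1\<close>.\<close>

definition curve_length :: "(real \<Rightarrow> 'a::metric_space) \<Rightarrow> ennreal" where
  "curve_length g = (SUP (n, t) \<in> {(n, t :: nat \<Rightarrow> real). mono_on {..n} t \<and> t ` {..n} \<subseteq> {0..1}}.
     ennreal (\<Sum>i<n. dist (g (t i)) (g (t (Suc i)))))"

definition rectifiable_curves :: "'a::metric_space set \<Rightarrow> 'a \<Rightarrow> 'a \<Rightarrow> (real \<Rightarrow> 'a) set" where
  "rectifiable_curves K x y = {g. path g \<and> path_image g \<subseteq> K \<and> curve_length g < \<infinity> \<and>
     pathstart g = x \<and> pathfinish g = y}"

definition finitely_arcwise_connected :: "'a::metric_space set \<Rightarrow> bool" where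
  "finitely_arcwise_connected K \<longleftrightarrow> (\<forall>x\<in>K. \<forall>y\<in>K. rectifiable_curves K x y \<noteq> {})"

definition d_geo :: "'a::metric_space set \<Rightarrow> 'a \<Rightarrow> 'a \<Rightarrow> ennreal" where
  "d_geo K x y = (INF g\<in>rectifiable_curves K x y. curve_length g)"


section \<open>The discrete spectral triple\<close>

type_synonym ('k, 'a) index = "'k list \<times> 'a \<times> 'a"

definition triple_space :: "('k \<Rightarrow> 'a \<Rightarrow> 'a) \<Rightarrow> ('k, 'a) index ell2 set" where
  "triple_space w = ell2_on (UNIV \<times> edges0 w)"

text \<open>\<open>Abs_ell2\<close> is only meaningful on square-summable families. This holds for
  \<open>rep w f x\<close> if \<open>f\<close> is continuous on \<open>K\<close> and \<open>x\<close> lies in \<open>triple_space w\<close>.\<close>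

definition rep ::
  "('k \<Rightarrow> 'a \<Rightarrow> 'a) \<Rightarrow> ('a \<Rightarrow> complex) \<Rightarrow> ('k, 'a) index ell2 \<Rightarrow> ('k, 'a) index ell2" where
  "rep w f x = Abs_ell2 (\<lambda>(\<sigma>, e). f (word_map w \<sigma> (fst e)) * coord x (\<sigma>, e))"

text \<open>\<open>D \<delta>\<^bsub>\<sigma>,e\<^esub> = lam\<^bsup>-|\<sigma>|\<^esup> \<ell>(e)\<^bsup>-1\<^esup> \<delta>\<^bsub>\<sigma>,e'\<^esub>\<close> with \<open>e'\<close> the reversed edge, so the
  \<open>(\<sigma>, e)\<close> coordinate of \<open>D x\<close> is the following number; the self-adjoint operator \<open>D\<close> is defined
  on all \<open>x\<close> for which these numbers are square-summable.\<close>

definition dirac_coord ::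
  "real \<Rightarrow> ('k, 'a::metric_space) index ell2 \<Rightarrow> ('k, 'a) index \<Rightarrow> complex" where
  "dirac_coord lam x =
     (\<lambda>(\<sigma>, e). of_real (1 / (lam ^ length \<sigma> * edge_length e)) * coord x (\<sigma>, prod.swap e))"

definition dirac_domain ::
  "('k \<Rightarrow> 'a::metric_space \<Rightarrow> 'a) \<Rightarrow> real \<Rightarrow> ('k, 'a) index ell2 set" where
  "dirac_domain w lam = {x \<in> triple_space w. square_summable (dirac_coord lam x)}"

definition dirac ::
  "real \<Rightarrow> ('k, 'a::metric_space) index ell2 \<Rightarrow> ('k, 'a) index ell2" where
  "dirac lam x = Abs_ell2 (dirac_coord lam x)"

text \<open>\<open>T\<close> is the bounded extension of the commutator \<open>[D, f]\<close>, which is densely defined on the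
  domain of \<open>D\<close>.\<close>

definition extends_commutator ::
  "('k \<Rightarrow> 'a::metric_space \<Rightarrow> 'a) \<Rightarrow> real \<Rightarrow> ('a \<Rightarrow> complex) \<Rightarrow>
     (('k, 'a) index ell2 \<Rightarrow> ('k, 'a) index ell2) \<Rightarrow> bool" where
  "extends_commutator w lam f T \<longleftrightarrow> T \<in> bounded_ops (triple_space w) \<and>
     (\<forall>x\<in>dirac_domain w lam. rep w f x \<in> dirac_domain w lam \<and>
        T x = dirac lam (rep w f x) - rep w f (dirac lam x))"

definition commutator ::
  "('k \<Rightarrow> 'a::metric_space \<Rightarrow> 'a) \<Rightarrow> real \<Rightarrow> ('a \<Rightarrow> complex) \<Rightarrow>
     ('k, 'a) index ell2 \<Rightarrow> ('k, 'a) index ell2" where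
  "commutator w lam f = (THE T. extends_commutator w lam f T)"

text \<open>Elements of \<open>C(K)\<close> are represented by functions on the whole space; only their
  values on \<open>K\<close> enter the constructions.\<close>

definition triple_algebra ::
  "('k \<Rightarrow> 'a::metric_space \<Rightarrow> 'a) \<Rightarrow> real \<Rightarrow> 'a set \<Rightarrow> ('a \<Rightarrow> complex) set" where
  "triple_algebra w lam K = {f. continuous_on K f \<and> (\<exists>T. extends_commutator w lam f T)}"

definition L_ess ::
  "('k \<Rightarrow> 'a::metric_space \<Rightarrow> 'a) \<Rightarrow> real \<Rightarrow> ('a \<Rightarrow> complex) \<Rightarrow> real" where
  "L_ess w lam f = ess_norm (triple_space w) (commutator w lam f)"

definition d_ess ::
  "('k \<Rightarrow> 'a::metric_space \<Rightarrow> 'a) \<Rightarrow> real \<Rightarrow> 'a set \<Rightarrow> 'a \<Rightarrow> 'a \<Rightarrow> ennreal" where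
  "d_ess w lam K x y =
     (SUP f\<in>{f \<in> triple_algebra w lam K. L_ess w lam f \<le> 1}. ennreal (cmod (f x - f y)))"

end

theory Submission
  imports Defs
begin

text \<open>
  The commutator \<open>[D, f]\<close> maps \<open>\<delta>\<^bsub>\<sigma>,e\<^esub>\<close> to a multiple of \<open>\<delta>\<^bsub>\<sigma>,e'\<^esub>\<close>, with \<open>e'\<close> the reversed
  edge and weight the difference quotient of \<open>f\<close> along the edge \<open>w\<^sub>\<sigma> e\<close>. Compact operators cannot
  compensate infinitely many large weights, so \<open>L_ess f \<le> 1\<close> means that for every \<open>\<epsilon> > 0\<close> the
  function \<open>f\<close> is \<open>(1 + \<epsilon>)\<close>-Lipschitz along all sufficiently small edges.

  A curve in \<open>K\<close> passes from one \<open>n\<close>-cell to another only through vertices, and consecutive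
  vertices on it are joined by an edge of level \<open>n\<close>. Hence \<open>\<bar>f x - f y\<bar>\<close> is at most
  \<open>1 + \<epsilon>\<close> times the length of the curve plus twice the oscillation of \<open>f\<close> on \<open>n\<close>-cells, and
  \<open>d_ess \<le> d_geo\<close>.

  Conversely, the infimal length \<open>d\<^sub>\<epsilon>(x, \<cdot>)\<close> of chains in \<open>K\<close> with steps of size at most \<open>\<epsilon>\<close> is
  1-Lipschitz along all edges of length at most \<open>\<epsilon>\<close>, so \<open>d\<^sub>\<epsilon> \<le> d_ess\<close>. (The function
  \<open>d_geo(x, \<cdot>)\<close> itself would not do: the endpoints of an edge may be farther apart in \<open>K\<close> than in
  the ambient space, at all scales.) By compactness of \<open>K\<close>, chains with \<open>\<epsilon> \<rightarrow> 0\<close> accumulate at a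
  curve of length at most \<open>sup d\<^sub>\<epsilon>\<close>, so \<open>d_geo \<le> d_ess\<close>.
\<close>

section \<open>Chains and Lipschitz curves\<close>

text \<open>The length travels with the chain as its last argument, so that induction on chains
  controls it and infima over chains are infima of sets of reals.\<close>

inductive chain :: "'a::metric_space set \<Rightarrow> real \<Rightarrow> 'a \<Rightarrow> 'a \<Rightarrow> real \<Rightarrow> bool"
  for K e x where
  chain_base: "x \<in> K \<Longrightarrow> chain K e x x 0"
| chain_step: "chain K e x y l \<Longrightarrow> z \<in> K \<Longrightarrow> dist y z \<le> e \<Longrightarrow> chain K e x z (l + dist y z)"

lemma chain_nonneg: "chain K e x y l \<Longrightarrow> 0 \<le> l"
  by (induction rule: chain.induct) auto

lemma chain_exists:
  assumes "connected K" "e > 0" "x \<in> K" "y \<in> K"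
  shows "\<exists>l. chain K e x y l"
proof (rule connected_induction_simple[OF assms(1,3,4)])
  show "\<exists>l. chain K e x x l" using chain_base assms(3) by blast
  fix a assume a: "a \<in> K"
  \<comment> \<open>Any two points of a ball of radius \<open>e/2\<close> are at most
    \<open>e\<close> apart, so one further step leads from a reachable point of the neighbourhood to
    each of its points.\<close>
  show "\<exists>T. openin (top_of_set K) T \<and> a \<in> T \<and>
    (\<forall>y\<in>T. \<forall>z\<in>T. (\<exists>l. chain K e x y l) \<longrightarrow> (\<exists>l. chain K e x z l))"
  proof (intro exI[of _ "K \<inter> ball a (e/2)"] conjI ballI impI)
    show "openin (top_of_set K) (K \<inter> ball a (e/2))" by (simp add: openin_open_Int)
    show "a \<in> K \<inter> ball a (e/2)" using a assms(2) by simp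
    fix y z assume y: "y \<in> K \<inter> ball a (e/2)" and z: "z \<in> K \<inter> ball a (e/2)"
      and "\<exists>l. chain K e x y l"
    moreover have "dist y z \<le> e"
      using y z dist_triangle_half_r[of a y e z] by simp
    ultimately show "\<exists>l. chain K e x z l" using chain_step by blast
  qed
qed

text \<open>The function d_e(x, .) of the outline. A real \<open>Inf\<close> is informative only for
  a nonempty set bounded below: \<open>chain_exists\<close> supplies the former for connected
  \<open>K\<close> and positive \<open>e\<close>, \<open>bdd_below_chain\<close> the latter.\<close>

definition chain_dist :: "'a::metric_space set \<Rightarrow> real \<Rightarrow> 'a \<Rightarrow> 'a \<Rightarrow> real" where
  "chain_dist K e x y = Inf {l. chain K e x y l}"

lemma bdd_below_chain: "bdd_below {l. chain K e x y l}"
  using chain_nonneg by (intro bdd_belowI[of _ 0]) auto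

lemma chain_dist_self:
  assumes "x \<in> K" shows "chain_dist K e x x = 0"
proof (rule antisym)
  show "chain_dist K e x x \<le> 0" unfolding chain_dist_def
    using chain_base[OF assms] by (intro cInf_lower bdd_below_chain) auto
  show "0 \<le> chain_dist K e x x" unfolding chain_dist_def
    using chain_base[OF assms, of e] chain_nonneg by (intro cInf_greatest) auto
qed

lemma chain_dist_nonneg:
  assumes "connected K" "e > 0" "x \<in> K" "y \<in> K" shows "0 \<le> chain_dist K e x y"
  unfolding chain_dist_def
  using chain_exists[OF assms] chain_nonneg by (intro cInf_greatest) auto

lemma chain_dist_step:
  assumes "connected K" "e > 0" "x \<in> K" "y \<in> K" "z \<in> K" "dist y z \<le> e"
  shows "chain_dist K e x z \<le> chain_dist K e x y + dist y z"
proof -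
  have "chain_dist K e x z - dist y z \<le> l" if "chain K e x y l" for l
    using cInf_lower[OF _ bdd_below_chain, of "l + dist y z" K e x z] chain_step[OF that assms(5,6)]
    unfolding chain_dist_def by auto
  then have "chain_dist K e x z - dist y z \<le> chain_dist K e x y"
    using chain_exists[OF assms(1-4)] unfolding chain_dist_def[of K e x y]
    by (intro cInf_greatest) auto
  then show ?thesis by simp
qed

text \<open>A chain ending at one of the two points extends to the other by a single step. The
  constant is exactly 1 for the ambient distance, which bounds the difference quotients along small
  edges by 1.\<close>

lemma chain_dist_local_lipschitz:
  assumes "connected K" "e > 0" "x \<in> K" "y \<in> K" "z \<in> K" "dist y z \<le> e"
  shows "\<bar>chain_dist K e x y - chain_dist K e x z\<bar> \<le> dist y z"
  using chain_dist_step[OF assms] chain_dist_step[OF assms(1-3,5,4)] assms(6)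
  by (simp add: dist_commute abs_le_iff)

lemma continuous_on_chain_dist:
  assumes "connected K" "e > 0" "x \<in> K"
  shows "continuous_on K (chain_dist K e x)"
  unfolding continuous_on_iff
proof (intro ballI allI impI)
  fix y and r :: real assume y: "y \<in> K" and r: "0 < r"
  have "dist (chain_dist K e x z) (chain_dist K e x y) < r"
    if "z \<in> K" "dist z y < min e r" for z
    using chain_dist_local_lipschitz[OF assms(1-3) that(1) y] that by (simp add: dist_real_def)
  then show "\<exists>d>0. \<forall>z\<in>K. dist z y < d \<longrightarrow> dist (chain_dist K e x z) (chain_dist K e x y) < r"
    using r assms(2) by (intro exI[of _ "min e r"]) auto
qed

text \<open>Parametrise the chain by length: wait at each point for as long as the coming step is
  long, then jump. Only the first jump after time \<open>s\<close> can cost an extra \<bar>e\<bar>;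
  every later one is paid for by the wait before it.\<close>

lemma chain_imp_step_function:
  assumes "chain K e x y l"
  shows "\<exists>h. h 0 = x \<and> h l = y \<and> (\<forall>t. h t \<in> K) \<and>
    (\<forall>s t. 0 \<le> s \<and> s \<le> t \<and> t \<le> l \<longrightarrow> dist (h s) (h t) \<le> t - s + \<bar>e\<bar>)"
  using assms
proof induction
  case chain_base
  then show ?case by (intro exI[of _ "\<lambda>_. x"]) auto
next
  case (chain_step y l z)
  then obtain h where h: "h 0 = x" "h l = y" "\<And>t. h t \<in> K"
      "\<And>s t. 0 \<le> s \<Longrightarrow> s \<le> t \<Longrightarrow> t \<le> l \<Longrightarrow> dist (h s) (h t) \<le> t - s + \<bar>e\<bar>"
    by blast
  have l: "0 \<le> l" using chain_step chain_nonneg by blast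
  let ?d = "dist y z"
  define h' where "h' t = (if t < l + ?d then if t \<le> l then h t else y else z)" for t
  have "dist (h' s) (h' t) \<le> t - s + \<bar>e\<bar>" if "0 \<le> s" "s \<le> t" "t \<le> l + ?d" for s t
  proof -
    have "t < l + ?d \<and> t \<le> l \<or> t < l + ?d \<and> s \<le> l \<and> l < t \<or> t < l + ?d \<and> l < s
      \<or> t = l + ?d \<and> s < l \<or> t = l + ?d \<and> l \<le> s \<and> s < t \<or> s = t"
      using that by linarith
    then consider "t < l + ?d" "t \<le> l" | "t < l + ?d" "s \<le> l" "l < t" | "t < l + ?d" "l < s"
      | "t = l + ?d" "s < l" | "t = l + ?d" "l \<le> s" "s < t" | "s = t"
      by blast
    then show ?thesis
    proof cases
      case 1 then show ?thesis using h(4)[of s t] that by (simp add: h'_def)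
    next
      case 3 then show ?thesis using that by (simp add: h'_def)
    next
      case 6 then show ?thesis by simp
    next
      case 2 then show ?thesis using h(4)[of s l] that h(2) by (simp add: h'_def)
    next
      case 4
      have "dist (h s) z \<le> dist (h s) y + ?d" by (rule dist_triangle)
      moreover have "h' s = h s"
        using 4 by (simp add: h'_def) (use zero_le_dist[of y z] in linarith)
      ultimately show ?thesis using h(4)[of s l] 4 that h(2) by (simp add: h'_def)
    next
      case 5 then show ?thesis using that h(2) chain_step by (auto simp: h'_def)
    qed
  qed
  moreover have "h' 0 = x"
  proof (cases "l + ?d = 0")
    case True
    then have "l = 0" "?d = 0" using l zero_le_dist[of y z] by linarith+
    then show ?thesis using h(1,2) by (simp add: h'_def)
  next
    case False
    then have "0 < l + ?d" using l zero_le_dist[of y z] by linarith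
    then show ?thesis using h(1) l by (simp add: h'_def)
  qed
  moreover have "h' (l + ?d) = z" by (simp add: h'_def)
  moreover have "h' t \<in> K" for t
    using h(3)[of t] h(3)[of l] h(2) chain_step(2) by (simp add: h'_def)
  ultimately show ?case by (intro exI[of _ h']) auto
qed

text \<open>The curve is a cluster point, in the product topology, of the step functions along finer
  and finer chains.\<close>

lemma chains_imp_lipschitz_curve:
  fixes K :: "'a::metric_space set"
  assumes K: "compact K" and M: "0 \<le> M"
    and ch: "\<forall>e>0. \<exists>l. chain K e x y l \<and> l \<le> M + e"
  shows "\<exists>g. g 0 = x \<and> g 1 = y \<and> (\<forall>t. g t \<in> K) \<and>
    (\<forall>s t. 0 \<le> s \<and> s \<le> t \<and> t \<le> 1 \<longrightarrow> dist (g s) (g t) \<le> M * (t - s))"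
proof -
  \<comment> \<open>Curves from \<open>x\<close> to \<open>y\<close>, not assumed continuous, that
    are Lipschitz with constant \<open>M + e\<close> up to an error \<open>e\<close>. Each condition
    concerns one or two coordinates and is a weak inequality, hence closed in the product
    topology.\<close>
  define F :: "real \<Rightarrow> (real \<Rightarrow> 'a) set" where
    "F e = {g. dist (g 0) x \<le> 0} \<inter> {g. dist (g 1) y \<le> 0} \<inter>
      (\<Inter>(s, t) \<in> {(s, t). 0 \<le> s \<and> s \<le> t \<and> t \<le> 1}.
        {g. dist (g s) (g t) \<le> (M + e) * (t - s) + e})" for e
  have cont: "continuous_on UNIV (\<lambda>g :: real \<Rightarrow> 'a. g i)" for i
    by (rule continuous_on_product_coordinates)
  have closedF: "closed (F e)" for e
    unfolding F_def
    by (intro closed_Int closed_INT ballI) (auto simp del: dist_le_zero_iff intro!: closed_Collect_le continuous_intros cont)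
  have F_mono: "F e \<subseteq> F e'" if "e \<le> e'" for e e'
  proof -
    have "(M + e) * (t - s) + e \<le> (M + e') * (t - s) + e'" if "s \<le> t" for s t
      using that \<open>e \<le> e'\<close> by (intro add_mono mult_right_mono) auto
    then have "dist (g s) (g t) \<le> (M + e') * (t - s) + e'"
      if "dist (g s) (g t) \<le> (M + e) * (t - s) + e" "s \<le> t" for g :: "real \<Rightarrow> 'a" and s t
      using that order_trans by blast
    then show ?thesis unfolding F_def by auto
  qed
  have mem_F: "g \<in> F e \<longleftrightarrow> g 0 = x \<and> g 1 = y \<and>
      (\<forall>s t. 0 \<le> s \<and> s \<le> t \<and> t \<le> 1 \<longrightarrow> dist (g s) (g t) \<le> (M + e) * (t - s) + e)" for g e
    by (auto simp: F_def)
  have F_ne: "Pi\<^sub>E UNIV (\<lambda>_. K) \<inter> F e \<noteq> {}" if e: "e > 0" for e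
  proof -
    obtain l where l: "chain K e x y l" "l \<le> M + e" using ch e by blast
    obtain h where h: "h 0 = x" "h l = y" "\<And>t. h t \<in> K"
      "\<And>s t. 0 \<le> s \<Longrightarrow> s \<le> t \<Longrightarrow> t \<le> l \<Longrightarrow> dist (h s) (h t) \<le> t - s + \<bar>e\<bar>"
      using chain_imp_step_function[OF l(1)] by blast
    have l0: "0 \<le> l" using chain_nonneg[OF l(1)] .
    \<comment> \<open>Rescaling from the interval of length \<open>l\<close> to the unit interval
      turns slope 1 into slope \<open>l\<close>, which is at most \<open>M + e\<close>.\<close>
    have "dist (h (l * s)) (h (l * t)) \<le> (M + e) * (t - s) + e"
      if "0 \<le> s" "s \<le> t" "t \<le> 1" for s t
    proof -
      have "dist (h (l * s)) (h (l * t)) \<le> l * t - l * s + \<bar>e\<bar>"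
        using that l0 by (intro h(4)) (auto intro: mult_left_mono mult_left_le)
      also have "\<dots> = l * (t - s) + e" using e by (simp add: algebra_simps)
      also have "\<dots> \<le> (M + e) * (t - s) + e"
        using that l by (intro add_right_mono mult_right_mono) auto
      finally show ?thesis .
    qed
    then have "(\<lambda>t. h (l * t)) \<in> Pi\<^sub>E UNIV (\<lambda>_. K) \<inter> F e"
      using h(1-3) by (auto simp: mem_F)
    then show ?thesis by blast
  qed
  \<comment> \<open>By Tychonoff the functions into \<open>K\<close> form a compact set, so it
    suffices that any finitely many of the closed sets \<open>F e\<close> meet in it.\<close>
  have "compactin (product_topology (\<lambda>_. euclidean) UNIV) (Pi\<^sub>E (UNIV::real set) (\<lambda>_. K))"
    by (simp add: compactin_PiE K)
  then have "compact (Pi\<^sub>E (UNIV::real set) (\<lambda>_. K))"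
    by (simp add: euclidean_product_topology)
  then have "Pi\<^sub>E UNIV (\<lambda>_. K) \<inter> (\<Inter>e\<in>{0<..}. F e) \<noteq> {}"
  proof (rule compact_imp_fip_image)
    fix I' :: "real set" assume I': "finite I'" "I' \<subseteq> {0<..}"
    \<comment> \<open>\<open>F\<close> is increasing in \<open>e\<close>, so the smallest index
      decides; the inserted 1 covers the empty index set.\<close>
    define e where "e = Min (insert 1 I')"
    have e: "e > 0" using I' by (auto simp: e_def)
    have "F e \<subseteq> (\<Inter>e\<in>I'. F e)"
      using I' by (intro INT_greatest F_mono) (auto simp: e_def)
    then have "Pi\<^sub>E UNIV (\<lambda>_. K) \<inter> F e \<subseteq> Pi\<^sub>E UNIV (\<lambda>_. K) \<inter> (\<Inter>e\<in>I'. F e)"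
      by (rule Int_mono[OF order_refl])
    then show "Pi\<^sub>E UNIV (\<lambda>_. K) \<inter> (\<Inter>e\<in>I'. F e) \<noteq> {}"
      using F_ne[OF e] by (metis subset_empty)
  qed (rule closedF)
  then obtain g where "g \<in> Pi\<^sub>E UNIV (\<lambda>_. K) \<inter> (\<Inter>e\<in>{0<..}. F e)"
    unfolding ex_in_conv[symmetric] by (elim exE)
  then have g: "\<forall>t. g t \<in> K" "\<forall>e>0. g \<in> F e" by auto
  have "dist (g s) (g t) \<le> M * (t - s)" if st: "0 \<le> s" "s \<le> t" "t \<le> 1" for s t
  proof (rule field_le_epsilon)
    fix e :: real assume e: "e > 0"
    have "dist (g s) (g t) \<le> (M + e/2) * (t - s) + e/2"
      using g(2)[rule_format, of "e/2"] e st unfolding mem_F by simp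
    also have "\<dots> = M * (t - s) + e / 2 * (t - s) + e/2" by (simp add: algebra_simps)
    also have "e / 2 * (t - s) \<le> e / 2 * 1" using st e by (intro mult_left_mono) auto
    finally show "dist (g s) (g t) \<le> M * (t - s) + e" by simp
  qed
  moreover have "g 0 = x" "g 1 = y" using g(2)[rule_format, of 1] by (simp_all add: mem_F)
  ultimately show ?thesis using g(1) by blast
qed

section \<open>Lengths of Lipschitz curves and arc length of rectifiable curves\<close>

lemma curve_length_lipschitz:
  assumes M: "0 \<le> M"
    and lip: "\<forall>s t. 0 \<le> s \<and> s \<le> t \<and> t \<le> 1 \<longrightarrow> dist (g s) (g t) \<le> M * (t - s)"
  shows "curve_length g \<le> ennreal M"
  unfolding curve_length_def
proof (rule SUP_least, safe)
  fix n and t :: "nat \<Rightarrow> real" assume t: "mono_on {..n} t" "t ` {..n} \<subseteq> {0..1}"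
  have "(\<Sum>i<n. dist (g (t i)) (g (t (Suc i)))) \<le> (\<Sum>i<n. M * (t (Suc i) - t i))"
    using t by (intro sum_mono lip[rule_format]) (auto simp: mono_on_def image_subset_iff)
  also have "\<dots> = M * (t n - t 0)"
    by (simp add: sum_distrib_left[symmetric] sum_lessThan_telescope)
  also have "M * (t n - t 0) \<le> M"
  proof -
    have "t n \<le> 1" "0 \<le> t 0" using t by (auto simp: image_subset_iff)
    then show ?thesis using M mult_left_mono[of "t n - t 0" 1 M] by simp
  qed
  finally show "ennreal (\<Sum>i<n. dist (g (t i)) (g (t (Suc i)))) \<le> ennreal M"
    by (simp add: ennreal_leI)
qed

text \<open>The step functions of chains need not be continuous, but the limit is
  \<open>M\<close>-Lipschitz, hence a path, and competes in the infimum defining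
  \<open>d_geo\<close>.\<close>

lemma d_geo_le_if_chains:
  assumes "compact K" "0 \<le> M" "\<forall>e>0. \<exists>l. chain K e x y l \<and> l \<le> M + e"
  shows "d_geo K x y \<le> ennreal M"
proof -
  obtain g where g: "g 0 = x" "g 1 = y" "\<forall>t. g t \<in> K"
    and lip: "\<forall>s t. 0 \<le> s \<and> s \<le> t \<and> t \<le> 1 \<longrightarrow> dist (g s) (g t) \<le> M * (t - s)"
    using chains_imp_lipschitz_curve[OF assms] by blast
  have "M-lipschitz_on {0..1} g"
  proof (rule lipschitz_onI)
    fix s t :: real assume "s \<in> {0..1}" "t \<in> {0..1}"
    then show "dist (g s) (g t) \<le> M * dist s t"
      using lip[rule_format, of s t] lip[rule_format, of t s] by (cases "s \<le> t") (auto simp: dist_real_def dist_commute)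
  qed (fact assms(2))
  then have "continuous_on {0..1} g" by (rule lipschitz_on_continuous_on)
  moreover have len: "curve_length g \<le> ennreal M"
    using curve_length_lipschitz[OF assms(2) lip] .
  moreover have "curve_length g < \<infinity>"
    using len le_less_trans by fastforce
  ultimately have "g \<in> rectifiable_curves K x y"
    using g by (auto simp: rectifiable_curves_def path_def path_image_def pathstart_def pathfinish_def)
  then show ?thesis unfolding d_geo_def using len by (meson INF_lower2)
qed

text \<open>\<open>L r\<close> is the length of the curve on [0, r]. Its increments dominate
  distances, which lets the later arguments cut a curve at arbitrary times without handling
  partitions.\<close>

lemma arc_length_function:
  fixes g :: "real \<Rightarrow> 'a::metric_space"
  assumes fin: "curve_length g < \<infinity>"
  obtains L :: "real \<Rightarrow> real" where
    "\<forall>s t. 0 \<le> s \<and> s \<le> t \<and> t \<le> 1 \<longrightarrow> dist (g s) (g t) \<le> L t - L s"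
    "L 1 - L 0 \<le> enn2real (curve_length g)"
proof -
  define S where "S r = {(\<Sum>i<n. dist (g (t i)) (g (t (Suc i)))) | n (t :: nat \<Rightarrow> real).
    mono_on {..n} t \<and> t ` {..n} \<subseteq> {0..r}}" for r
  define L where "L r = Sup (S r)" for r
  have bound: "a \<le> enn2real (curve_length g)" if "r \<le> 1" "a \<in> S r" for a r
  proof -
    obtain n and t :: "nat \<Rightarrow> real" where t: "mono_on {..n} t" "t ` {..n} \<subseteq> {0..r}"
      and a: "a = (\<Sum>i<n. dist (g (t i)) (g (t (Suc i))))"
      using \<open>a \<in> S r\<close> unfolding S_def by blast
    have "ennreal a \<le> curve_length g"
      unfolding curve_length_def a
      using t \<open>r \<le> 1\<close> by (intro SUP_upper2[of "(n, t)"]) auto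
    then show ?thesis
      using fin by (metis enn2real_ennreal enn2real_mono infinity_ennreal_def a sum_nonneg zero_le_dist)
  qed
  have bdd: "bdd_above (S r)" if "r \<le> 1" for r
    using bound[OF that] by (rule bdd_aboveI)
  have S0: "0 \<in> S r" if "0 \<le> r" for r
    unfolding S_def using that by (auto intro!: exI[of _ "0::nat"] exI[of _ "\<lambda>_. 0"] mono_onI)
  have len: "dist (g s) (g t) \<le> L t - L s" if st: "0 \<le> s" "s \<le> t" "t \<le> 1" for s t
  proof -
    have "a \<le> L t - dist (g s) (g t)" if "a \<in> S s" for a
    proof -
      obtain n and u :: "nat \<Rightarrow> real" where u: "mono_on {..n} u" "u ` {..n} \<subseteq> {0..s}"
        and a: "a = (\<Sum>i<n. dist (g (u i)) (g (u (Suc i))))"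
        using \<open>a \<in> S s\<close> unfolding S_def mem_Collect_eq by (elim exE conjE)
      \<comment> \<open>The partition \<open>u\<close> of [0, s] is continued by \<open>s\<close>
        and \<open>t\<close>. The step from \<open>u n\<close> to \<open>s\<close> adds a
        nonnegative amount, the last one adds the distance sought.\<close>
      define v where "v i = (if i \<le> n then u i else if i = Suc n then s else t)" for i
      have us: "0 \<le> u i" "u i \<le> s" if "i \<le> n" for i using u(2) that by auto
      have "v i \<le> v j" if "i \<le> j" for i j
        using that us[of i] mono_onD[OF u(1), of i j] st(2) by (simp add: v_def) linarith
      then have "mono_on {..Suc (Suc n)} v" by (simp add: mono_on_def)
      moreover have "v i \<in> {0..t}" for i
        using us[of i] st by (cases "i \<le> n") (auto simp: v_def)
      then have "v ` {..Suc (Suc n)} \<subseteq> {0..t}" by blast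
      ultimately have "(\<Sum>i<Suc (Suc n). dist (g (v i)) (g (v (Suc i)))) \<in> S t"
        unfolding S_def by (intro CollectI exI[of _ "Suc (Suc n)"] exI[of _ v] conjI refl)
      then have "(\<Sum>i<Suc (Suc n). dist (g (v i)) (g (v (Suc i)))) \<le> L t"
        unfolding L_def using bdd[OF st(3)] by (rule cSup_upper)
      moreover have "(\<Sum>i<n. dist (g (v i)) (g (v (Suc i)))) = a"
        unfolding a by (intro sum.cong) (auto simp: v_def)
      ultimately have "a + dist (g (v n)) (g (v (Suc n))) + dist (g s) (g t) \<le> L t"
        by (simp add: v_def)
      then show ?thesis using zero_le_dist[of "g (v n)" "g (v (Suc n))"] by linarith
    qed
    then have "L s \<le> L t - dist (g s) (g t)"
      unfolding L_def[of s] using S0[OF st(1)] by (intro cSup_least) auto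
    then show ?thesis by simp
  qed
  show thesis
  proof (rule that[of L])
    show "\<forall>s t. 0 \<le> s \<and> s \<le> t \<and> t \<le> 1 \<longrightarrow> dist (g s) (g t) \<le> L t - L s"
      using len by blast
    have "L 1 \<le> enn2real (curve_length g)"
      unfolding L_def using S0[of 1] bound[of 1] by (intro cSup_least) auto
    moreover have "0 \<le> L 0" unfolding L_def using S0[of 0] bdd[of 0] by (intro cSup_upper) auto
    ultimately show "L 1 - L 0 \<le> enn2real (curve_length g)" by simp
  qed
qed

section \<open>Weighted permutation operators and their essential norm\<close>

lemma coord_eqI: "(\<And>i. coord x i = coord y i) \<Longrightarrow> x = y"
  by (metis coord_inject ext)

lemma coord_Abs_ell2: "square_summable g \<Longrightarrow> coord (Abs_ell2 g) = g"
  by (simp add: Abs_ell2_inverse)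

lemma square_summable_finite_support:
  assumes "finite F" "\<And>i. i \<notin> F \<Longrightarrow> x i = 0"
  shows "square_summable x"
proof -
  have "(\<lambda>i. (cmod (x i))\<^sup>2) summable_on F" using assms(1) by (rule summable_on_finite)
  then show ?thesis unfolding square_summable_def
    by (rule summable_on_cong_neutral[THEN iffD1, rotated -1]) (use assms(2) in auto)
qed

text \<open>The permutation is built in because the commutator reads coordinates at reversed edges;
  with the identity the same estimate covers multiplication by \<open>f\<close> and
  truncation.\<close>

lemma square_summable_dominated:
  assumes \<pi>: "bij \<pi>" and le: "\<And>i. cmod (g i) \<le> B * cmod (coord x (\<pi> i))"
  shows "square_summable g"
proof -
  have "(\<lambda>i. (cmod (coord x (\<pi> i)))\<^sup>2) summable_on UNIV"
    using summable_on_reindex_bij_betw[OF \<pi>, of "\<lambda>i. (cmod (coord x i))\<^sup>2"]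
      square_summable_coord[of x] by (simp add: square_summable_def)
  then have "(\<lambda>i. B\<^sup>2 * (cmod (coord x (\<pi> i)))\<^sup>2) summable_on UNIV"
    by (rule summable_on_cmult_right)
  then show ?thesis unfolding square_summable_def
  proof (rule summable_on_comparison_test)
    fix i show "(cmod (g i))\<^sup>2 \<le> B\<^sup>2 * (cmod (coord x (\<pi> i)))\<^sup>2"
      using power_mono[OF le, of i 2] by (simp add: power_mult_distrib)
  qed auto
qed

lemma norm_dominated:
  assumes \<pi>: "bij \<pi>" and B: "0 \<le> B" and le: "\<And>i. cmod (coord y i) \<le> B * cmod (coord x (\<pi> i))"
  shows "norm y \<le> B * norm x"
proof -
  have s: "(\<lambda>i. (cmod (coord x (\<pi> i)))\<^sup>2) summable_on UNIV"
    using summable_on_reindex_bij_betw[OF \<pi>, of "\<lambda>i. (cmod (coord x i))\<^sup>2"]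
      square_summable_coord[of x] by (simp add: square_summable_def)
  have "(norm y)\<^sup>2 \<le> (\<Sum>\<^sub>\<infinity>i. B\<^sup>2 * (cmod (coord x (\<pi> i)))\<^sup>2)"
    unfolding norm_ell2_power2
  proof (rule infsum_mono)
    show "(\<lambda>i. (cmod (coord y i))\<^sup>2) summable_on UNIV"
      using square_summable_coord[of y] by (simp add: square_summable_def)
    show "(\<lambda>i. B\<^sup>2 * (cmod (coord x (\<pi> i)))\<^sup>2) summable_on UNIV"
      using s by (rule summable_on_cmult_right)
    fix i show "(cmod (coord y i))\<^sup>2 \<le> B\<^sup>2 * (cmod (coord x (\<pi> i)))\<^sup>2"
      using power_mono[OF le, of i 2] by (simp add: power_mult_distrib)
  qed
  also have "\<dots> = B\<^sup>2 * (norm x)\<^sup>2"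
    unfolding norm_ell2_power2
    using infsum_reindex_bij_betw[OF \<pi>, of "\<lambda>i. (cmod (coord x i))\<^sup>2"]
    by (simp add: infsum_cmult_right')
  finally have "(norm y)\<^sup>2 \<le> (B * norm x)\<^sup>2" by (simp add: power_mult_distrib)
  then show ?thesis using B by (simp add: power2_le_iff_abs_le)
qed

lemma norm_scale_ell2: "norm (scale_ell2 c x) = cmod c * norm x"
proof -
  have "(norm (scale_ell2 c x))\<^sup>2 = (cmod c * norm x)\<^sup>2"
    by (simp add: norm_ell2_power2 scale_ell2.rep_eq norm_mult power_mult_distrib infsum_cmult_right')
  then show ?thesis by (metis abs_of_nonneg norm_ge_zero mult_nonneg_nonneg power2_eq_iff_nonneg)
qed

lemma zero_in_ell2_on: "0 \<in> ell2_on I"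
  by (simp add: ell2_on_def zero_ell2.rep_eq)

section \<open>Basis vectors and truncation to finitely many coordinates\<close>

definition unit_vec :: "'i \<Rightarrow> 'i ell2" where
  "unit_vec i = Abs_ell2 (\<lambda>j. if j = i then 1 else 0)"

lemma coord_unit_vec: "coord (unit_vec i) j = (if j = i then 1 else 0)"
proof -
  have "square_summable (\<lambda>j. if j = i then 1 else 0)"
    by (rule square_summable_finite_support[of "{i}"]) simp_all
  then show ?thesis by (simp add: unit_vec_def coord_Abs_ell2)
qed

lemma norm_unit_vec: "norm (unit_vec i) = 1"
proof -
  have "(norm (unit_vec i))\<^sup>2 = (\<Sum>\<^sub>\<infinity>j\<in>{i}. (cmod (coord (unit_vec i) j))\<^sup>2)"
    unfolding norm_ell2_power2 by (rule infsum_cong_neutral) (auto simp: coord_unit_vec)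
  then show ?thesis by (simp add: coord_unit_vec power2_eq_1_iff)
    (use norm_ge_zero[of "unit_vec i"] in linarith)
qed

definition truncate :: "'i set \<Rightarrow> 'i ell2 \<Rightarrow> 'i ell2" where
  "truncate F x = Abs_ell2 (\<lambda>i. if i \<in> F then coord x i else 0)"

lemma coord_truncate: "coord (truncate F x) i = (if i \<in> F then coord x i else 0)"
proof -
  have "square_summable (\<lambda>i. if i \<in> F then coord x i else 0)"
    by (rule square_summable_dominated[OF bij_id, of _ 1 x]) simp
  then show ?thesis by (simp add: truncate_def coord_Abs_ell2)
qed

text \<open>The squared norm of the tail is the full sum minus a partial sum. A prescribed index
  \<open>j\<close> may be included since enlarging \<open>F\<close> does no harm;
  \<open>eq_weighted_permI\<close> uses this to keep the coordinate it reads.\<close>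

lemma truncate_approx:
  assumes "r > 0"
  obtains F where "finite F" "j \<in> F" "norm (x - truncate F x) < r"
proof -
  let ?f = "\<lambda>i. (cmod (coord x i))\<^sup>2"
  have s: "?f summable_on UNIV" using square_summable_coord[of x] by (simp add: square_summable_def)
  then have "(?f has_sum infsum ?f UNIV) UNIV" by (rule has_sum_infsum)
  then have "eventually (\<lambda>F. dist (sum ?f F) (infsum ?f UNIV) < r\<^sup>2) (finite_subsets_at_top UNIV)"
    using assms unfolding has_sum_def tendsto_iff by simp
  then obtain F0 where F0: "finite F0"
    "\<And>F. finite F \<Longrightarrow> F0 \<subseteq> F \<Longrightarrow> dist (sum ?f F) (infsum ?f UNIV) < r\<^sup>2"
    by (auto simp: eventually_finite_subsets_at_top)
  define F where "F = insert j F0"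
  have F: "finite F" using F0 by (simp add: F_def)
  have "(norm (x - truncate F x))\<^sup>2 = infsum ?f (UNIV - F)"
    unfolding norm_ell2_power2
    by (rule infsum_cong_neutral) (auto simp: minus_ell2.rep_eq coord_truncate)
  also have "\<dots> = infsum ?f UNIV - sum ?f F"
    using F s by (subst infsum_Diff) auto
  also have "\<dots> < r\<^sup>2" using F0(2)[of F] F by (simp add: F_def dist_real_def subset_insertI abs_less_iff)
  finally have "norm (x - truncate F x) < r"
    using assms by (simp add: power2_less_imp_less)
  then show ?thesis using that F by (auto simp: F_def)
qed

lemma finite_large_coords:
  assumes "r > 0" shows "finite {i. r \<le> cmod (coord x i)}"
proof -
  obtain F where F: "finite F" "norm (x - truncate F x) < r"
    using truncate_approx[OF assms] by metis
  have "{i. r \<le> cmod (coord x i)} \<subseteq> F"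
  proof (rule subsetI, rule ccontr)
    fix i assume "i \<in> {i. r \<le> cmod (coord x i)}" "i \<notin> F"
    then show False using cmod_coord_le_norm[of "x - truncate F x" i] F
      by (simp add: minus_ell2.rep_eq coord_truncate)
  qed
  then show ?thesis using F finite_subset by blast
qed

section \<open>Bounded operators and the distance to compact ones\<close>

lemma bounded_ops_PiE: "T \<in> bounded_ops H \<Longrightarrow> T \<in> H \<rightarrow>\<^sub>E H"
  unfolding bounded_ops_def mem_Collect_eq by (elim conjE)

lemma bounded_ops_bound:
  assumes "T \<in> bounded_ops H"
  obtains B where "B \<ge> 0" "\<And>x. x \<in> H \<Longrightarrow> norm (T x) \<le> B * norm x"
proof -
  obtain B where B: "\<forall>x\<in>H. norm (T x) \<le> B * norm x" using assms by (auto simp: bounded_ops_def)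
  have "norm (T x) \<le> \<bar>B\<bar> * norm x" if "x \<in> H" for x
    using B that by (meson abs_ge_self mult_right_mono norm_ge_zero order_trans)
  then show thesis using that[of "\<bar>B\<bar>"] by auto
qed

lemma op_norm_diff_bdd:
  assumes "T \<in> bounded_ops H" "C \<in> bounded_ops H"
  shows "bdd_above ((\<lambda>x. norm (T x - C x)) ` (H \<inter> cball 0 1))"
proof -
  obtain A where A: "A \<ge> 0" "\<And>x. x \<in> H \<Longrightarrow> norm (T x) \<le> A * norm x"
    using bounded_ops_bound[OF assms(1)] by blast
  obtain B where B: "B \<ge> 0" "\<And>x. x \<in> H \<Longrightarrow> norm (C x) \<le> B * norm x"
    using bounded_ops_bound[OF assms(2)] by blast
  have "norm (T x - C x) \<le> A + B" if "x \<in> H \<inter> cball 0 1" for x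
  proof -
    have "norm (T x - C x) \<le> norm (T x) + norm (C x)" by (rule norm_triangle_ineq4)
    also have "norm (T x) \<le> A" using A that mult_left_le[of "norm x" A] by fastforce
    also have "norm (C x) \<le> B" using B that mult_left_le[of "norm x" B] by fastforce
    finally show ?thesis by simp
  qed
  then show ?thesis by (rule bdd_aboveI2)
qed

lemma norm_le_op_norm_diff:
  assumes "T \<in> bounded_ops H" "C \<in> bounded_ops H" "x \<in> H" "norm x \<le> 1"
  shows "norm (T x - C x) \<le> op_norm H (\<lambda>x. T x - C x)"
  unfolding op_norm_def using assms(3,4)
  by (intro cSUP_upper[OF _ op_norm_diff_bdd[OF assms(1,2)], of x]) simp

lemma ess_norm_le_op_norm:
  assumes T: "T \<in> bounded_ops (ell2_on I)" and C: "C \<in> compact_ops (ell2_on I)"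
  shows "ess_norm (ell2_on I) T \<le> op_norm (ell2_on I) (\<lambda>x. T x - C x)"
  unfolding ess_norm_def
proof (rule cINF_lower[OF _ C])
  have "0 \<le> op_norm (ell2_on I) (\<lambda>x. T x - C x)" if "C \<in> compact_ops (ell2_on I)" for C
    using norm_le_op_norm_diff[OF T, of C 0] that zero_in_ell2_on order_trans[OF norm_ge_zero]
    by (fastforce simp: compact_ops_def)
  then show "bdd_below ((\<lambda>C. op_norm (ell2_on I) (\<lambda>x. T x - C x)) ` compact_ops (ell2_on I))"
    by (rule bdd_belowI2)
qed

text \<open>A new index \<open>j\<close> turns the set into the Minkowski sum of the previous one
  and a compact disc in direction \<open>j\<close>.\<close>

lemma compact_finite_support:
  assumes "finite F"
  shows "compact {x :: 'i ell2. (\<forall>i. i \<notin> F \<longrightarrow> coord x i = 0) \<and> (\<forall>i. cmod (coord x i) \<le> B)}"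
  using assms
proof (induction F)
  case empty
  have "{x :: 'i ell2. (\<forall>i. i \<notin> {} \<longrightarrow> coord x i = 0) \<and> (\<forall>i. cmod (coord x i) \<le> B)} \<subseteq> {0}"
    by (auto intro!: coord_eqI simp: zero_ell2.rep_eq)
  then show ?case by (meson finite.emptyI finite.insertI finite_imp_compact finite_subset)
next
  case (insert j F)
  let ?S = "\<lambda>F. {x :: 'i ell2. (\<forall>i. i \<notin> F \<longrightarrow> coord x i = 0) \<and> (\<forall>i. cmod (coord x i) \<le> B)}"
  let ?u = "\<lambda>c. scale_ell2 c (unit_vec j)"
  have "1-lipschitz_on (cball 0 B) ?u"
  proof (rule lipschitz_onI)
    fix c d :: complex
    have "?u c - ?u d = ?u (c - d)"
      by (rule coord_eqI) (simp add: minus_ell2.rep_eq scale_ell2.rep_eq algebra_simps)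
    then show "dist (?u c) (?u d) \<le> 1 * dist c d"
      by (simp add: dist_norm norm_scale_ell2 norm_unit_vec)
  qed simp
  then have "compact (?u ` cball 0 B)"
    by (intro compact_continuous_image lipschitz_on_continuous_on) auto
  then have "compact {x + y |x y. x \<in> ?u ` cball 0 B \<and> y \<in> ?S F}"
    using insert.IH by (rule compact_sums)
  also have "{x + y |x y. x \<in> ?u ` cball 0 B \<and> y \<in> ?S F} = ?S (insert j F)" (is "?A = ?B")
  proof
    show "?A \<subseteq> ?B"
      using insert.hyps by (auto simp: plus_ell2.rep_eq scale_ell2.rep_eq coord_unit_vec)
    show "?B \<subseteq> ?A"
    proof
      fix x assume x: "x \<in> ?B"
      have "x = ?u (coord x j) + truncate F x"
        using x insert.hyps
        by (intro coord_eqI) (auto simp: plus_ell2.rep_eq scale_ell2.rep_eq coord_unit_vec coord_truncate)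
      moreover have "coord x j \<in> cball 0 B" using x by simp
      moreover have "0 \<le> B" using x norm_ge_zero order_trans by blast
      then have "truncate F x \<in> ?S F" using x by (auto simp: coord_truncate)
      ultimately show "x \<in> ?A" by blast
    qed
  qed
  finally show ?case .
qed

text \<open>The restricted lambda makes the operator extensional off \<open>ell2_on I\<close>, as
  \<open>bounded_ops\<close> demands. The commutator [D, f] will be of this form, with edge reversal
  as permutation and difference quotients as weights.\<close>

definition weighted_perm :: "'i set \<Rightarrow> ('i \<Rightarrow> complex) \<Rightarrow> ('i \<Rightarrow> 'i) \<Rightarrow> 'i ell2 \<Rightarrow> 'i ell2" where
  "weighted_perm I m \<pi> = (\<lambda>x\<in>ell2_on I. Abs_ell2 (\<lambda>i. m i * coord x (\<pi> i)))"

locale permuted_index =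
  fixes I :: "'i set" and \<pi> :: "'i \<Rightarrow> 'i"
  assumes bij: "bij \<pi>" and perm_iff: "\<pi> i \<in> I \<longleftrightarrow> i \<in> I"
begin

lemma weighted_le:
  assumes "\<forall>i\<in>I. cmod (m i) \<le> B" "x \<in> ell2_on I"
  shows "cmod (m i * coord x (\<pi> i)) \<le> B * cmod (coord x (\<pi> i))"
proof (cases "i \<in> I")
  case True then show ?thesis using assms by (simp add: norm_mult mult_right_mono)
next
  \<comment> \<open>Weights are bounded only on \<open>I\<close>, but outside \<open>I\<close> the
    permuted index is outside as well and the coordinate vanishes.\<close>
  case False then show ?thesis using assms perm_iff[of i] by (simp add: ell2_on_def)
qed

lemma coord_weighted_perm:
  assumes "\<forall>i\<in>I. cmod (m i) \<le> B" "x \<in> ell2_on I"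
  shows "coord (weighted_perm I m \<pi> x) i = m i * coord x (\<pi> i)"
proof -
  have "square_summable (\<lambda>i. m i * coord x (\<pi> i))"
    by (rule square_summable_dominated[OF bij]) (rule weighted_le[OF assms])
  then show ?thesis using assms(2) by (simp add: weighted_perm_def coord_Abs_ell2)
qed

lemma weighted_perm_in:
  assumes "\<forall>i\<in>I. cmod (m i) \<le> B" "x \<in> ell2_on I"
  shows "weighted_perm I m \<pi> x \<in> ell2_on I"
proof -
  have "coord (weighted_perm I m \<pi> x) i = 0" if "i \<notin> I" for i
    using assms(2) that perm_iff[of i] by (simp add: coord_weighted_perm[OF assms]) (simp add: ell2_on_def)
  then show ?thesis by (simp add: ell2_on_def)
qed

lemma norm_weighted_perm:
  assumes "\<forall>i\<in>I. cmod (m i) \<le> B" "x \<in> ell2_on I" "0 \<le> B"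
  shows "norm (weighted_perm I m \<pi> x) \<le> B * norm x"
proof (rule norm_dominated[OF bij assms(3)])
  fix i show "cmod (coord (weighted_perm I m \<pi> x) i) \<le> B * cmod (coord x (\<pi> i))"
    unfolding coord_weighted_perm[OF assms(1,2)] by (rule weighted_le[OF assms(1,2)])
qed

lemma weighted_perm_bounded:
  assumes m: "\<forall>i\<in>I. cmod (m i) \<le> B"
  shows "weighted_perm I m \<pi> \<in> bounded_ops (ell2_on I)"
proof -
  \<comment> \<open>For empty \<open>I\<close> the given bound may be negative.\<close>
  have m': "\<forall>i\<in>I. cmod (m i) \<le> \<bar>B\<bar>" using m by (meson abs_ge_self order_trans)
  have closed: "x + y \<in> ell2_on I" "scale_ell2 c x \<in> ell2_on I"
    if "x \<in> ell2_on I" "y \<in> ell2_on I" for x y c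
    using that by (auto simp: ell2_on_def plus_ell2.rep_eq scale_ell2.rep_eq)
  have "weighted_perm I m \<pi> \<in> ell2_on I \<rightarrow>\<^sub>E ell2_on I"
    using weighted_perm_in[OF m] by (auto simp: PiE_def weighted_perm_def)
  moreover have "weighted_perm I m \<pi> (x + y) = weighted_perm I m \<pi> x + weighted_perm I m \<pi> y"
    if "x \<in> ell2_on I" "y \<in> ell2_on I" for x y
    using that closed
    by (intro coord_eqI) (simp add: coord_weighted_perm[OF m] plus_ell2.rep_eq algebra_simps)
  moreover have "weighted_perm I m \<pi> (scale_ell2 c x) = scale_ell2 c (weighted_perm I m \<pi> x)"
    if "x \<in> ell2_on I" for x c
    using that closed
    by (intro coord_eqI) (simp add: coord_weighted_perm[OF m] scale_ell2.rep_eq)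
  moreover have "norm (weighted_perm I m \<pi> x) \<le> \<bar>B\<bar> * norm x" if "x \<in> ell2_on I" for x
    using norm_weighted_perm[OF m' that] by simp
  ultimately show ?thesis
    unfolding bounded_ops_def mem_Collect_eq
    by (intro conjI ballI allI exI[of _ "\<bar>B\<bar>"])
qed

text \<open>The operator has finite rank: it maps the unit ball into a bounded set of vectors
  supported in \<open>F\<close>.\<close>

lemma weighted_perm_compact:
  assumes F: "finite F" and m: "\<And>i. i \<notin> F \<Longrightarrow> m i = 0"
  shows "weighted_perm I m \<pi> \<in> compact_ops (ell2_on I)"
proof -
  define B where "B = Max (insert 0 ((cmod \<circ> m) ` F))"
  have B: "0 \<le> B" using F by (simp add: B_def)
  have mB: "\<forall>i\<in>I. cmod (m i) \<le> B"
  proof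
    fix i show "cmod (m i) \<le> B"
      using F m[of i] by (cases "i \<in> F") (auto simp: B_def intro!: Max_ge)
  qed
  let ?S = "{x :: 'i ell2. (\<forall>i. i \<notin> F \<longrightarrow> coord x i = 0) \<and> (\<forall>i. cmod (coord x i) \<le> B)}"
  have "weighted_perm I m \<pi> x \<in> ?S" if "x \<in> ell2_on I" "x \<in> cball 0 1" for x
  proof -
    have "coord (weighted_perm I m \<pi> x) i = 0" if "i \<notin> F" for i
      using that \<open>x \<in> ell2_on I\<close> m by (simp add: coord_weighted_perm[OF mB])
    moreover have "cmod (coord (weighted_perm I m \<pi> x) i) \<le> B" for i
    proof -
      have "cmod (coord (weighted_perm I m \<pi> x) i) \<le> norm (weighted_perm I m \<pi> x)"
        by (rule cmod_coord_le_norm)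
      also have "\<dots> \<le> B * norm x" using that B by (intro norm_weighted_perm mB)
      also have "\<dots> \<le> B" using that B by (simp add: mult_left_le)
      finally show ?thesis .
    qed
    ultimately show ?thesis by blast
  qed
  then have sub: "weighted_perm I m \<pi> ` (ell2_on I \<inter> cball 0 1) \<subseteq> ?S" by blast
  have "compact ?S" using F by (rule compact_finite_support)
  then have "compact (closure (weighted_perm I m \<pi> ` (ell2_on I \<inter> cball 0 1)))"
    using closure_minimal[OF sub] compact_Int_closed[OF \<open>compact ?S\<close> closed_closure]
    by (metis (lifting) \<open>compact ?S\<close> compact_imp_closed Int_absorb1)
  then show ?thesis using weighted_perm_bounded[OF mB] by (simp add: compact_ops_def)
qed

text \<open>Subtract the operator with the weights on \<open>F\<close> only; it is compact, and the
  remaining weights are at most \<open>c\<close>.\<close>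

lemma ess_norm_weighted_perm_le:
  assumes m: "\<forall>i\<in>I. cmod (m i) \<le> B" and F: "finite F" and c: "0 \<le> c"
    and le: "\<forall>i\<in>I - F. cmod (m i) \<le> c"
  shows "ess_norm (ell2_on I) (weighted_perm I m \<pi>) \<le> c"
proof -
  define k where "k i = (if i \<in> F \<inter> I then m i else 0)" for i
  have kB: "\<forall>i\<in>I. cmod (k i) \<le> \<bar>B\<bar>" using m by (auto simp: k_def)
  have K: "weighted_perm I k \<pi> \<in> compact_ops (ell2_on I)"
    using F by (intro weighted_perm_compact[of F]) (auto simp: k_def)
  have "ess_norm (ell2_on I) (weighted_perm I m \<pi>) \<le>
    op_norm (ell2_on I) (\<lambda>x. weighted_perm I m \<pi> x - weighted_perm I k \<pi> x)"
    by (intro ess_norm_le_op_norm K weighted_perm_bounded[OF m])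
  also have "\<dots> \<le> c" unfolding op_norm_def
  proof (rule cSUP_least)
    show "ell2_on I \<inter> cball 0 1 \<noteq> {}" using zero_in_ell2_on by fastforce
    fix x assume x: "x \<in> ell2_on I \<inter> cball 0 1"
    have "norm (weighted_perm I m \<pi> x - weighted_perm I k \<pi> x) \<le> c * norm x"
    proof (rule norm_dominated[OF bij c])
      fix i
      have "cmod ((m i - k i) * coord x (\<pi> i)) \<le> c * cmod (coord x (\<pi> i))"
        using x le c by (intro weighted_le) (auto simp: k_def)
      then show "cmod (coord (weighted_perm I m \<pi> x - weighted_perm I k \<pi> x) i)
          \<le> c * cmod (coord x (\<pi> i))"
        using x by (simp add: minus_ell2.rep_eq coord_weighted_perm[OF m]
            coord_weighted_perm[OF kB] algebra_simps)
    qed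
    also have "\<dots> \<le> c" using x c by (simp add: mult_left_le)
    finally show "norm (weighted_perm I m \<pi> x - weighted_perm I k \<pi> x) \<le> c" .
  qed
  finally show ?thesis .
qed

text \<open>If \<open>C\<close> is compact and \<open>C \<delta>\<^sub>i\<close> converges to \<open>y\<close> along a sequence of distinct \<open>i\<close>, then the
  \<open>i\<close>-th coordinate of \<open>y\<close> tends to 0, so \<open>C\<close> cannot cancel infinitely many large weights.\<close>

lemma finite_weights_above_ess_norm:
  assumes m: "\<forall>i\<in>I. cmod (m i) \<le> B"
    and less: "ess_norm (ell2_on I) (weighted_perm I m \<pi>) < c"
  shows "finite {i \<in> I. c \<le> cmod (m i)}"
proof (rule ccontr)
  let ?T = "weighted_perm I m \<pi>"
  assume inf: "infinite {i \<in> I. c \<le> cmod (m i)}"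
  have "\<exists>s :: nat \<Rightarrow> 'i. inj s \<and> range s \<subseteq> {i \<in> I. c \<le> cmod (m i)}"
    by (rule infinite_countable_subset[OF inf])
  then obtain s :: "nat \<Rightarrow> 'i" where s: "inj s" "range s \<subseteq> {i \<in> I. c \<le> cmod (m i)}"
    by (elim exE conjE)
  have T: "?T \<in> bounded_ops (ell2_on I)" by (rule weighted_perm_bounded[OF m])
  have "weighted_perm I (\<lambda>_. 0) \<pi> \<in> compact_ops (ell2_on I)"
    by (rule weighted_perm_compact[of "{}"]) auto
  then have ne: "compact_ops (ell2_on I) \<noteq> {}" by blast
  obtain C where C: "C \<in> compact_ops (ell2_on I)" "op_norm (ell2_on I) (\<lambda>x. ?T x - C x) < c"
    using cInf_lessD[OF _ less[unfolded ess_norm_def]] ne by auto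
  define \<eta> where "\<eta> = c - op_norm (ell2_on I) (\<lambda>x. ?T x - C x)"
  have \<eta>: "\<eta> > 0" using C by (simp add: \<eta>_def)
  have unit: "unit_vec (\<pi> i) \<in> ell2_on I" if "i \<in> I" for i
    using that perm_iff by (auto simp: ell2_on_def coord_unit_vec)
  \<comment> \<open>The i-th coordinate of \<open>?T (unit_vec (\<pi> i))\<close> is
    \<open>m i\<close>, of modulus at least \<open>c\<close>, while \<open>?T\<close> and
    \<open>C\<close> differ by at most \<open>c - \<eta>\<close> on the unit ball.\<close>
  have big: "\<eta> \<le> cmod (coord (C (unit_vec (\<pi> i))) i)" if "i \<in> I" "c \<le> cmod (m i)" for i
  proof -
    have "cmod (coord (?T (unit_vec (\<pi> i)) - C (unit_vec (\<pi> i))) i)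
        \<le> norm (?T (unit_vec (\<pi> i)) - C (unit_vec (\<pi> i)))"
      by (rule cmod_coord_le_norm)
    also have "\<dots> \<le> c - \<eta>"
      using norm_le_op_norm_diff[OF T, of C "unit_vec (\<pi> i)"] C unit[OF that(1)]
      by (simp add: \<eta>_def norm_unit_vec compact_ops_def)
    finally have "cmod (m i - coord (C (unit_vec (\<pi> i))) i) \<le> c - \<eta>"
      using unit[OF that(1)]
      by (simp add: minus_ell2.rep_eq coord_weighted_perm[OF m] coord_unit_vec)
    then show ?thesis
      using that(2) norm_triangle_ineq2[of "m i" "coord (C (unit_vec (\<pi> i))) i"] by linarith
  qed
  have "C (unit_vec (\<pi> (s n))) \<in> closure (C ` (ell2_on I \<inter> cball 0 1))" for n
    using s unit by (intro subsetD[OF closure_subset] imageI) (auto simp: norm_unit_vec)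
  then have in_cl: "\<forall>n. C (unit_vec (\<pi> (s n))) \<in> closure (C ` (ell2_on I \<inter> cball 0 1))" by blast
  have "seq_compact (closure (C ` (ell2_on I \<inter> cball 0 1)))"
    using C(1) by (simp add: compact_ops_def compact_imp_seq_compact)
  then obtain y r where "y \<in> closure (C ` (ell2_on I \<inter> cball 0 1))"
    and r: "strict_mono (r :: nat \<Rightarrow> nat)"
    and lim: "((\<lambda>n. C (unit_vec (\<pi> (s n)))) \<circ> r) \<longlonglongrightarrow> y"
    using in_cl by (rule seq_compactE)
  have "eventually (\<lambda>n. dist (C (unit_vec (\<pi> (s (r n))))) y < \<eta> / 2) sequentially"
    using tendstoD[OF lim, of "\<eta> / 2"] \<eta> by (simp add: o_def)
  then obtain N where N: "\<And>n. n \<ge> N \<Longrightarrow> dist (C (unit_vec (\<pi> (s (r n))))) y < \<eta> / 2"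
    by (auto simp: eventually_sequentially)
  have "\<eta> / 2 \<le> cmod (coord y (s (r n)))" if "n \<ge> N" for n
  proof -
    let ?x = "C (unit_vec (\<pi> (s (r n))))"
    have "\<eta> \<le> cmod (coord ?x (s (r n)))" using s by (intro big) auto
    moreover have "cmod (coord ?x (s (r n)) - coord y (s (r n))) < \<eta> / 2"
      using cmod_coord_le_norm[of "?x - y" "s (r n)"] N[OF that]
      by (simp add: minus_ell2.rep_eq dist_norm)
    ultimately show ?thesis
      using norm_triangle_ineq2[of "coord ?x (s (r n))" "coord y (s (r n))"] by linarith
  qed
  then have "(s \<circ> r) ` {N..} \<subseteq> {i. \<eta> / 2 \<le> cmod (coord y i)}" by auto
  moreover have "infinite ((s \<circ> r) ` {N..})"
    using s r by (metis finite_imageD infinite_Ici inj_compose inj_on_subset strict_mono_imp_inj_on subset_UNIV)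
  ultimately show False using finite_large_coords[of "\<eta>/2" y] \<eta> finite_subset by auto
qed

text \<open>Finitely supported vectors are dense, so they determine a bounded operator.\<close>

lemma eq_weighted_permI:
  assumes T: "T \<in> bounded_ops (ell2_on I)" and m: "\<forall>i\<in>I. cmod (m i) \<le> B"
    and fin: "\<And>x F i. finite F \<Longrightarrow> x \<in> ell2_on I \<Longrightarrow> x \<in> ell2_on F \<Longrightarrow>
      coord (T x) i = m i * coord x (\<pi> i)"
  shows "T = weighted_perm I m \<pi>"
proof -
  let ?W = "weighted_perm I m \<pi>"
  obtain A where A: "A \<ge> 0" "\<And>x. x \<in> ell2_on I \<Longrightarrow> norm (T x) \<le> A * norm x"
    using bounded_ops_bound[OF T] by blast
  have coord_eq: "coord (T x) i = coord (?W x) i" if x: "x \<in> ell2_on I" for x i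
  proof -
    have "cmod (coord (T x) i - coord (?W x) i) \<le> r" if "r > 0" for r
    proof -
      \<comment> \<open>Dividing by \<open>A + 1\<close> is safe even if \<open>A\<close> is 0. With
        \<open>\<pi> i\<close> in \<open>F\<close> the truncation keeps the only coordinate on which
        the i-th coordinate of the weighted permutation depends.\<close>
      obtain F where F: "finite F" "\<pi> i \<in> F" "norm (x - truncate F x) < r / (A + 1)"
        using truncate_approx[of "r / (A + 1)"] A(1) \<open>r > 0\<close> by (metis add_nonneg_pos divide_pos_pos zero_less_one)
      have tI: "truncate F x \<in> ell2_on I" and dI: "x - truncate F x \<in> ell2_on I"
        using x by (auto simp: ell2_on_def coord_truncate minus_ell2.rep_eq)
      have "T (truncate F x + (x - truncate F x)) = T (truncate F x) + T (x - truncate F x)"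
        using T tI dI unfolding bounded_ops_def by blast
      then have "T x = T (truncate F x) + T (x - truncate F x)" by simp
      moreover have "coord (T (truncate F x)) i = m i * coord x (\<pi> i)"
        using fin[OF F(1) tI] F(2) by (simp add: ell2_on_def coord_truncate)
      ultimately have "coord (T x) i - coord (?W x) i = coord (T (x - truncate F x)) i"
        by (simp add: plus_ell2.rep_eq coord_weighted_perm[OF m x])
      also have "cmod \<dots> \<le> norm (T (x - truncate F x))" by (rule cmod_coord_le_norm)
      also have "\<dots> \<le> A * norm (x - truncate F x)" using A(2) dI .
      also have "\<dots> \<le> (A + 1) * (r / (A + 1))" using A(1) F(3) by (intro mult_mono) auto
      also have "\<dots> = r" using A(1) by simp
      finally show ?thesis .
    qed
    then have "cmod (coord (T x) i - coord (?W x) i) \<le> 0" by (rule dense_ge)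
    then show ?thesis by simp
  qed
  have "T x = ?W x" if "x \<in> ell2_on I" for x by (rule coord_eqI) (rule coord_eq[OF that])
  then show ?thesis
    by (rule PiE_ext[OF bounded_ops_PiE[OF T] bounded_ops_PiE[OF weighted_perm_bounded[OF m]]])
qed

end

section \<open>Cells of a nested fractal\<close>

lemma compact_preimage_interval:
  fixes g :: "real \<Rightarrow> 'a::topological_space"
  assumes "continuous_on {a..b} g" "closed C"
  shows "compact {t \<in> {a..b}. g t \<in> C}"
proof -
  have "{t \<in> {a..b}. g t \<in> C} = {a..b} \<inter> ({a..b} \<inter> g -` C)" by auto
  moreover have "closed ({a..b} \<inter> g -` C)"
    using assms by (intro continuous_closed_preimage) auto
  ultimately show ?thesis by (simp only: compact_Int_closed[OF compact_Icc])
qed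

section \<open>The attractor, its cells and its vertices\<close>

locale fractal =
  fixes w :: "'k::finite \<Rightarrow> 'a::euclidean_space \<Rightarrow> 'a" and lam :: real and K :: "'a set"
  assumes nested: "nested_fractal w lam K"
begin

lemma similarity: "contracting_similarity lam (w i)"
  using nested unfolding nested_fractal_def by (elim conjE) (erule spec)

lemma lam: "0 < lam" "lam < 1" and dist_map: "dist (w i x) (w i y) = lam * dist x y"
  using similarity unfolding contracting_similarity_def by simp_all

lemma compact_K: "compact K"
  using nested unfolding nested_fractal_def by (elim conjE)

lemma K_ne: "K \<noteq> {}"
  using nested unfolding nested_fractal_def by (elim conjE)

lemma K_eq: "K = (\<Union>i. w i ` K)"
  using nested unfolding nested_fractal_def by (elim conjE)

lemma cells_meet:
  assumes "\<sigma> \<in> words n" "\<tau> \<in> words n" "\<sigma> \<noteq> \<tau>"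
  shows "word_map w \<sigma> ` K \<inter> word_map w \<tau> ` K =
    word_map w \<sigma> ` ess_fixed_points w \<inter> word_map w \<tau> ` ess_fixed_points w"
proof -
  have "\<forall>n. \<forall>\<sigma>\<in>words n. \<forall>\<sigma>'\<in>words n. \<sigma> \<noteq> \<sigma>' \<longrightarrow>
        word_map w \<sigma> ` ess_fixed_points w \<noteq> word_map w \<sigma>' ` ess_fixed_points w \<and>
        word_map w \<sigma> ` K \<inter> word_map w \<sigma>' ` K =
          word_map w \<sigma> ` ess_fixed_points w \<inter> word_map w \<sigma>' ` ess_fixed_points w"
    using nested unfolding nested_fractal_def by (elim conjE)
  then show ?thesis using assms by blast
qed

lemma map_in_K: "x \<in> K \<Longrightarrow> w i x \<in> K"
  by (subst K_eq) blast

lemma word_map_in_K: "x \<in> K \<Longrightarrow> word_map w \<sigma> x \<in> K"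
  by (induction \<sigma>) (auto simp: map_in_K)

lemma dist_word_map: "dist (word_map w \<sigma> x) (word_map w \<sigma> y) = lam ^ length \<sigma> * dist x y"
  by (induction \<sigma>) (auto simp: dist_map)

lemma cells_cover:
  assumes "x \<in> K" shows "\<exists>\<sigma>\<in>words n. x \<in> word_map w \<sigma> ` K"
  using assms
proof (induction n arbitrary: x)
  case 0
  then show ?case by (intro bexI[of _ "[]"]) (auto simp: words_def)
next
  case (Suc n)
  obtain i y where y: "y \<in> K" "x = w i y" using Suc.prems K_eq by blast
  obtain \<sigma> where "\<sigma> \<in> words n" "y \<in> word_map w \<sigma> ` K" using Suc.IH[OF y(1)] by blast
  then show ?case using y(2) by (intro bexI[of _ "i # \<sigma>"]) (auto simp: words_def)
qed

text \<open>Banach's theorem on \<open>K\<close> yields a fixed point inside \<open>K\<close>; since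
  the map contracts the whole space, that point is the one selected by \<open>THE\<close>.\<close>

lemma fixed_point_in_K: "fixed_point (w i) \<in> K"
proof -
  have "\<exists>!z\<in>K. w i z = z"
    using lam compact_K K_ne map_in_K
    by (intro Banach_fix[of K lam]) (auto simp: compact_imp_complete dist_map)
  then obtain z where z: "z \<in> K" "w i z = z" by blast
  have "p = z" if "w i p = p" for p
  proof -
    have "dist p z = lam * dist p z" using dist_map[of i p z] that z by simp
    then show ?thesis using lam by simp
  qed
  then have "fixed_point (w i) = z" unfolding fixed_point_def using z by blast
  then show ?thesis using z by simp
qed

lemma ess_in_K: "p \<in> ess_fixed_points w \<Longrightarrow> p \<in> K"
  using fixed_point_in_K by (auto simp: ess_fixed_points_def)

lemma finite_ess: "finite (ess_fixed_points w)"
  by (rule finite_subset[of _ "range (\<lambda>i. fixed_point (w i))"]) (auto simp: ess_fixed_points_def)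

lemma finite_edges0: "finite (edges0 w)"
  by (rule finite_subset[of _ "ess_fixed_points w \<times> ess_fixed_points w"])
    (auto simp: edges0_def finite_ess)

lemma finite_words: "finite (words n :: 'k list set)"
  using finite_lists_length_eq[of "UNIV :: 'k set" n] by (simp add: words_def)

lemma finite_vertices: "finite (vertices w n)"
  unfolding vertices_def using finite_words finite_ess by blast

lemma closed_cell: "closed (word_map w \<sigma> ` K)"
proof -
  have "1-lipschitz_on K (word_map w \<sigma>)"
  proof (rule lipschitz_onI)
    fix x y
    have "lam ^ length \<sigma> \<le> 1" using lam by (simp add: power_le_one)
    then show "dist (word_map w \<sigma> x) (word_map w \<sigma> y) \<le> 1 * dist x y"
      unfolding dist_word_map by (intro mult_right_mono) auto
  qed simp
  then show ?thesis
    using compact_K by (intro compact_imp_closed compact_continuous_image lipschitz_on_continuous_on)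
qed

lemma cells_meet_vertices:
  assumes "\<sigma> \<in> words n" "\<tau> \<in> words n" "\<sigma> \<noteq> \<tau>" "x \<in> word_map w \<sigma> ` K" "x \<in> word_map w \<tau> ` K"
  shows "x \<in> vertices w n"
  using cells_meet[OF assms(1-3)] assms unfolding vertices_def by blast

text \<open>If the vertex stems from another cell, it lies in the intersection of the two cells,
  which consists of common vertices. Hence two vertices of level \<open>n\<close> in one cell, if
  distinct, are the ends of an edge.\<close>

lemma vertex_of_cell:
  assumes "v \<in> vertices w n" "\<sigma> \<in> words n" "v \<in> word_map w \<sigma> ` K"
  shows "v \<in> word_map w \<sigma> ` ess_fixed_points w"
proof -
  obtain \<tau> where \<tau>: "\<tau> \<in> words n" "v \<in> word_map w \<tau> ` ess_fixed_points w"
    using assms(1) unfolding vertices_def by blast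
  then have "v \<in> word_map w \<tau> ` K" using ess_in_K by blast
  then show ?thesis using cells_meet[OF assms(2) \<tau>(1)] \<tau>(2) assms(3) by (cases "\<sigma> = \<tau>") auto
qed

text \<open>The open piece of curve is connected and covered by finitely many closed cells, which
  pairwise meet only in vertices. Avoiding vertices, it stays in one cell, and its end points follow
  by closedness.\<close>

lemma curve_between_vertices:
  fixes g :: "real \<Rightarrow> 'a"
  assumes "a < b" and cont: "continuous_on {a..b} g" and K: "g ` {a..b} \<subseteq> K"
    and avoid: "\<forall>t. a < t \<and> t < b \<longrightarrow> g t \<notin> vertices w n"
  obtains \<sigma> where "\<sigma> \<in> words n" "g a \<in> word_map w \<sigma> ` K" "g b \<in> word_map w \<sigma> ` K"
proof -
  let ?S = "g ` {a<..<b}"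
  have cl: "closure {a<..<b} = {a..b}" using \<open>a < b\<close> by (rule closure_greaterThanLessThan)
  have sub: "{a<..<b} \<subseteq> {a..b}" by auto
  have conn: "connected ?S"
    by (intro connected_continuous_image continuous_on_subset[OF cont sub]) auto
  define c where "c = (a + b) / 2"
  have c: "c \<in> {a<..<b}" using \<open>a < b\<close> by (simp add: c_def)
  then have "g c \<in> K" using K sub by blast
  then obtain \<sigma> where \<sigma>: "\<sigma> \<in> words n" "g c \<in> word_map w \<sigma> ` K"
    using cells_cover[of "g c" n] by blast
  define B where "B = (\<Union>\<tau>\<in>words n - {\<sigma>}. word_map w \<tau> ` K)"
  have "closed B" unfolding B_def using finite_words closed_cell by (intro closed_UN) auto
  moreover have "?S \<subseteq> word_map w \<sigma> ` K \<union> B"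
  proof
    fix x assume "x \<in> ?S"
    then have "x \<in> K" using K sub by blast
    then show "x \<in> word_map w \<sigma> ` K \<union> B"
      using cells_cover[of x n] unfolding B_def by blast
  qed
  moreover have "word_map w \<sigma> ` K \<inter> B \<inter> ?S = {}"
    using cells_meet_vertices[OF \<sigma>(1)] avoid unfolding B_def by fastforce
  moreover have "word_map w \<sigma> ` K \<inter> ?S \<noteq> {}" using \<sigma>(2) c by blast
  ultimately have "B \<inter> ?S = {}"
    using conn closed_cell[of \<sigma>] unfolding connected_closed by blast
  then have "?S \<subseteq> word_map w \<sigma> ` K" using \<open>?S \<subseteq> word_map w \<sigma> ` K \<union> B\<close> by blast
  then have "g ` {a..b} \<subseteq> word_map w \<sigma> ` K"
    using image_closure_subset[of "{a<..<b}" g "word_map w \<sigma> ` K"] cont closed_cell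
    unfolding cl by blast
  moreover have "a \<in> {a..b}" "b \<in> {a..b}" using \<open>a < b\<close> by auto
  ultimately have "g a \<in> word_map w \<sigma> ` K" "g b \<in> word_map w \<sigma> ` K" by blast+
  then show thesis by (rule that[OF \<sigma>(1)])
qed

text \<open>From the last visit of a vertex the curve stays in one cell up to the next vertex, and never
  returns to the former one; hence the induction on the number of vertices visited.\<close>

lemma curve_from_vertex_bound:
  fixes f :: "'a \<Rightarrow> complex" and g :: "real \<Rightarrow> 'a" and L :: "real \<Rightarrow> real"
  assumes c: "0 \<le> c"
    and edge: "\<forall>\<sigma>\<in>words n. \<forall>x\<in>word_map w \<sigma> ` ess_fixed_points w. \<forall>y\<in>word_map w \<sigma> ` ess_fixed_points w.
      cmod (f x - f y) \<le> c * dist x y"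
    and osc: "\<forall>\<sigma>\<in>words n. \<forall>x\<in>word_map w \<sigma> ` K. \<forall>y\<in>word_map w \<sigma> ` K. cmod (f x - f y) \<le> r"
    and "a \<le> b" "continuous_on {a..b} g" "g ` {a..b} \<subseteq> K" "g a \<in> vertices w n"
    and "\<forall>s t. a \<le> s \<and> s \<le> t \<and> t \<le> b \<longrightarrow> dist (g s) (g t) \<le> L t - L s"
  shows "cmod (f (g a) - f (g b)) \<le> c * (L b - L a) + r"
  using assms(4-)
proof (induction "card (vertices w n \<inter> g ` {a..b})" arbitrary: a rule: less_induct)
  case less
  note cont = less.prems(2) and K = less.prems(3) and len = less.prems(5)
  have L_mono: "L s \<le> L t" if "a \<le> s" "s \<le> t" "t \<le> b" for s t
    using len[rule_format, of s t] that zero_le_dist[of "g s" "g t"] by linarith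
  have r: "0 \<le> r"
  proof -
    have "g a \<in> K" using K less.prems(1) by (simp add: image_subset_iff)
    then obtain \<sigma> where "\<sigma> \<in> words n" "g a \<in> word_map w \<sigma> ` K"
      using cells_cover[of "g a" n] by blast
    then show ?thesis using osc by fastforce
  qed
  have "compact {t \<in> {a..b}. g t \<in> {g a}}"
    using cont by (rule compact_preimage_interval) simp
  moreover have "a \<in> {t \<in> {a..b}. g t \<in> {g a}}" using less.prems(1) by simp
  ultimately obtain s where s: "s \<in> {a..b}" "g s = g a" "\<And>t. t \<in> {a..b} \<Longrightarrow> g t = g a \<Longrightarrow> t \<le> s"
    using compact_attains_sup[of "{t \<in> {a..b}. g t \<in> {g a}}"] by auto
  have cont_s: "continuous_on {s..b} g" using s(1) by (intro continuous_on_subset[OF cont]) auto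
  \<comment> \<open>Visits to other vertices after the last visit \<open>s\<close> to
    \<open>g a\<close>. The set is compact because there are finitely many vertices, so a first such
    visit exists if there is any.\<close>
  let ?T = "{t \<in> {s..b}. g t \<in> vertices w n - {g a}}"
  have T: "compact ?T"
    using cont_s finite_vertices by (intro compact_preimage_interval finite_imp_closed) auto
  show ?case
  proof (cases "?T = {}")
    case True
    have "cmod (f (g s) - f (g b)) \<le> r"
    proof (cases "s = b")
      case False
      then have "s < b" using s(1) by simp
      moreover have "g t \<notin> vertices w n" if "s < t" "t < b" for t
      proof
        assume "g t \<in> vertices w n"
        moreover have "g t \<noteq> g a" using s(1) s(3)[of t] that by auto
        ultimately have "t \<in> ?T" using that by simp
        then show False using True by blast
      qed
      then have "\<forall>t. s < t \<and> t < b \<longrightarrow> g t \<notin> vertices w n" by blast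
      moreover have "g ` {s..b} \<subseteq> K" using K s(1) by auto
      ultimately obtain \<sigma> where "\<sigma> \<in> words n" "g s \<in> word_map w \<sigma> ` K" "g b \<in> word_map w \<sigma> ` K"
        using curve_between_vertices[OF _ cont_s] by metis
      then show ?thesis using osc by blast
    qed (use r in simp)
    moreover have "0 \<le> c * (L b - L a)" using c L_mono[of a b] less.prems(1) by simp
    ultimately show ?thesis using s(2) by simp
  next
    case False
    then obtain t where t: "t \<in> ?T" "\<And>t'. t' \<in> ?T \<Longrightarrow> t \<le> t'"
      using compact_attains_inf[OF T] by blast
    have st: "a \<le> s" "s < t" "t \<le> b" using t(1) s(1,2) by (auto simp: order_less_le)
    have avoid: "\<forall>t'. s < t' \<and> t' < t \<longrightarrow> g t' \<notin> vertices w n"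
    proof (intro allI impI notI)
      fix t' assume t': "s < t' \<and> t' < t" "g t' \<in> vertices w n"
      then have "g t' \<noteq> g a" using s(3)[of t'] st by auto
      then have "t' \<in> ?T" using t' st by simp
      then show False using t(2) t' by fastforce
    qed
    have "continuous_on {s..t} g" "g ` {s..t} \<subseteq> K"
      using continuous_on_subset[OF cont, of "{s..t}"] K st by auto
    then obtain \<sigma> where \<sigma>: "\<sigma> \<in> words n" "g s \<in> word_map w \<sigma> ` K" "g t \<in> word_map w \<sigma> ` K"
      using curve_between_vertices[OF st(2) _ _ avoid] by metis
    have "g s \<in> word_map w \<sigma> ` ess_fixed_points w" "g t \<in> word_map w \<sigma> ` ess_fixed_points w"
      using t(1) s(2) less.prems(4) \<sigma> by (auto intro!: vertex_of_cell)
    then have "cmod (f (g s) - f (g t)) \<le> c * dist (g s) (g t)"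
      using edge \<sigma>(1) by blast
    also have "\<dots> \<le> c * (L t - L s)" using c len[rule_format, of s t] st by (intro mult_left_mono) auto
    finally have 1: "cmod (f (g s) - f (g t)) \<le> c * (L t - L s)" .
    have 2: "cmod (f (g t) - f (g b)) \<le> c * (L b - L t) + r"
    proof (rule less.hyps)
      have "g a \<notin> g ` {t..b}"
      proof
        assume "g a \<in> g ` {t..b}"
        then obtain t' where "t' \<in> {t..b}" "g t' = g a" by auto
        then show False using s(3)[of t'] st by simp
      qed
      moreover have "g a \<in> g ` {a..b}" "g ` {t..b} \<subseteq> g ` {a..b}" using less.prems(1) st by auto
      ultimately have "vertices w n \<inter> g ` {t..b} \<subset> vertices w n \<inter> g ` {a..b}"
        using less.prems(4) by blast
      then show "card (vertices w n \<inter> g ` {t..b}) < card (vertices w n \<inter> g ` {a..b})"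
        by (intro psubset_card_mono) (simp_all add: finite_vertices)
      show "continuous_on {t..b} g" using st by (intro continuous_on_subset[OF cont]) auto
    qed (use t(1) st K len in auto)
    \<comment> \<open>As \<open>g s = g a\<close>, the loop between the times \<open>a\<close> and
      \<open>s\<close> does not affect the values of \<open>f\<close>; its length is added back by
      monotonicity of \<open>L\<close>.\<close>
    have "cmod (f (g a) - f (g b)) \<le> cmod (f (g s) - f (g t)) + cmod (f (g t) - f (g b))"
      unfolding s(2)[symmetric] using norm_triangle_ineq[of "f (g s) - f (g t)" "f (g t) - f (g b)"] by simp
    also have "\<dots> \<le> c * (L b - L s) + r" using 1 2 by (simp add: algebra_simps)
    also have "c * (L b - L s) \<le> c * (L b - L a)"
      using c L_mono[of a s] st by (intro mult_left_mono) auto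
    finally show ?thesis by simp
  qed
qed

text \<open>Up to the first vertex the curve stays in one cell, which costs a second
  \<open>r\<close>; from there on \<open>curve_from_vertex_bound\<close> applies. A curve meeting no
  vertex stays in a single cell.\<close>

lemma curve_bound:
  fixes f :: "'a \<Rightarrow> complex" and g :: "real \<Rightarrow> 'a" and L :: "real \<Rightarrow> real"
  assumes c: "0 \<le> c"
    and edge: "\<forall>\<sigma>\<in>words n. \<forall>x\<in>word_map w \<sigma> ` ess_fixed_points w. \<forall>y\<in>word_map w \<sigma> ` ess_fixed_points w.
      cmod (f x - f y) \<le> c * dist x y"
    and osc: "\<forall>\<sigma>\<in>words n. \<forall>x\<in>word_map w \<sigma> ` K. \<forall>y\<in>word_map w \<sigma> ` K. cmod (f x - f y) \<le> r"
    and ab: "a < b" and cont: "continuous_on {a..b} g" and K: "g ` {a..b} \<subseteq> K"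
    and len: "\<forall>s t. a \<le> s \<and> s \<le> t \<and> t \<le> b \<longrightarrow> dist (g s) (g t) \<le> L t - L s"
  shows "cmod (f (g a) - f (g b)) \<le> c * (L b - L a) + 2 * r"
proof -
  have L_mono: "L s \<le> L t" if "a \<le> s" "s \<le> t" "t \<le> b" for s t
    using len[rule_format, of s t] that zero_le_dist[of "g s" "g t"] by linarith
  have r: "0 \<le> r"
  proof -
    have "g a \<in> K" using K ab by (simp add: image_subset_iff)
    then obtain \<sigma> where "\<sigma> \<in> words n" "g a \<in> word_map w \<sigma> ` K"
      using cells_cover[of "g a" n] by blast
    then show ?thesis using osc by fastforce
  qed
  let ?T = "{t \<in> {a..b}. g t \<in> vertices w n}"
  have T: "compact ?T"
    using cont finite_vertices by (intro compact_preimage_interval finite_imp_closed) auto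
  show ?thesis
  proof (cases "?T = {}")
    case True
    then have "\<forall>t. a < t \<and> t < b \<longrightarrow> g t \<notin> vertices w n" by auto
    then obtain \<sigma> where "\<sigma> \<in> words n" "g a \<in> word_map w \<sigma> ` K" "g b \<in> word_map w \<sigma> ` K"
      by (rule curve_between_vertices[OF ab cont K])
    then have "cmod (f (g a) - f (g b)) \<le> r" using osc by blast
    moreover have "0 \<le> c * (L b - L a)" using c L_mono[of a b] ab by simp
    ultimately show ?thesis using r by linarith
  next
    case False
    then obtain t where t: "t \<in> ?T" "\<And>t'. t' \<in> ?T \<Longrightarrow> t \<le> t'"
      using compact_attains_inf[OF T] by blast
    have "cmod (f (g a) - f (g t)) \<le> r"
    proof (cases "t = a")
      case False
      then have "a < t" using t(1) by auto
      moreover have "continuous_on {a..t} g" "g ` {a..t} \<subseteq> K"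
        using continuous_on_subset[OF cont, of "{a..t}"] K t(1) by auto
      moreover have "\<forall>t'. a < t' \<and> t' < t \<longrightarrow> g t' \<notin> vertices w n"
      proof (intro allI impI notI)
        fix t' assume "a < t' \<and> t' < t" "g t' \<in> vertices w n"
        then show False using t(1) t(2)[of t'] by auto
      qed
      ultimately obtain \<sigma> where "\<sigma> \<in> words n" "g a \<in> word_map w \<sigma> ` K" "g t \<in> word_map w \<sigma> ` K"
        by (rule curve_between_vertices)
      then show ?thesis using osc by blast
    qed (use r in simp)
    moreover have "cmod (f (g t) - f (g b)) \<le> c * (L b - L t) + r"
      using t(1) K len continuous_on_subset[OF cont, of "{t..b}"]
      by (intro curve_from_vertex_bound[OF c edge osc]) auto
    moreover have "c * (L b - L t) \<le> c * (L b - L a)"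
      using c L_mono[of a t] t(1) by (intro mult_left_mono) auto
    moreover have "cmod (f (g a) - f (g b)) \<le> cmod (f (g a) - f (g t)) + cmod (f (g t) - f (g b))"
      using norm_triangle_ineq[of "f (g a) - f (g t)" "f (g t) - f (g b)"] by simp
    ultimately show ?thesis by linarith
  qed
qed

lemma cells_small:
  assumes "e > 0"
  obtains n where "\<forall>\<sigma> x y. n \<le> length \<sigma> \<and> x \<in> K \<and> y \<in> K \<longrightarrow>
    dist (word_map w \<sigma> x) (word_map w \<sigma> y) < e"
proof -
  define d where "d = diameter K + 1"
  have d: "0 < d" using diameter_ge_0[OF compact_imp_bounded[OF compact_K]] by (simp add: d_def)
  obtain n where n: "lam ^ n < e / d" using real_arch_pow_inv[of "e / d" lam] lam assms d by auto
  show thesis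
  proof (rule that, intro allI impI)
    fix \<sigma> :: "'k list" and x y assume *: "n \<le> length \<sigma> \<and> x \<in> K \<and> y \<in> K"
    have "lam ^ length \<sigma> * dist x y \<le> lam ^ n * d"
      using * lam diameter_bounded_bound[OF compact_imp_bounded[OF compact_K], of x y]
      by (intro mult_mono power_decreasing) (auto simp: d_def)
    also have "\<dots> < e" using n d by (simp add: field_simps)
    finally show "dist (word_map w \<sigma> x) (word_map w \<sigma> y) < e" by (simp add: dist_word_map)
  qed
qed

text \<open>Choose one level so deep that \<open>f\<close> is (1 + e)-Lipschitz along its edges and,
  by uniform continuity, oscillates by at most \<open>e\<close> on its cells.\<close>

lemma asymptotic_lipschitz_imp_le_length:
  fixes f :: "'a \<Rightarrow> complex"
  assumes f: "continuous_on K f"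
    and edge: "\<forall>e>0. \<exists>n. \<forall>\<sigma> p q. n \<le> length \<sigma> \<longrightarrow> p \<in> ess_fixed_points w \<longrightarrow>
      q \<in> ess_fixed_points w \<longrightarrow> cmod (f (word_map w \<sigma> p) - f (word_map w \<sigma> q)) \<le>
        (1 + e) * dist (word_map w \<sigma> p) (word_map w \<sigma> q)"
    and g: "g \<in> rectifiable_curves K x y"
  shows "ennreal (cmod (f x - f y)) \<le> curve_length g"
proof -
  have g': "continuous_on {0..1} g" "g ` {0..1} \<subseteq> K" "curve_length g < \<infinity>" "g 0 = x" "g 1 = y"
    using g by (auto simp: rectifiable_curves_def path_def path_image_def pathstart_def pathfinish_def)
  let ?l = "enn2real (curve_length g)"
  obtain L :: "real \<Rightarrow> real" where
    L: "\<forall>s t. 0 \<le> s \<and> s \<le> t \<and> t \<le> 1 \<longrightarrow> dist (g s) (g t) \<le> L t - L s" "L 1 - L 0 \<le> ?l"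
    by (rule arc_length_function[OF g'(3)])
  have bound: "cmod (f x - f y) \<le> (1 + e) * ?l + 2 * e" if e: "e > 0" for e
  proof -
    obtain N where N: "\<forall>\<sigma> p q. N \<le> length \<sigma> \<longrightarrow> p \<in> ess_fixed_points w \<longrightarrow>
      q \<in> ess_fixed_points w \<longrightarrow> cmod (f (word_map w \<sigma> p) - f (word_map w \<sigma> q)) \<le>
        (1 + e) * dist (word_map w \<sigma> p) (word_map w \<sigma> q)"
      using edge e by blast
    have "uniformly_continuous_on K f" using f compact_K by (rule compact_uniformly_continuous)
    then obtain d where d: "d > 0" "\<And>u v. u \<in> K \<Longrightarrow> v \<in> K \<Longrightarrow> dist v u < d \<Longrightarrow> dist (f v) (f u) < e"
      using e unfolding uniformly_continuous_on_def by metis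
    obtain M where M: "\<forall>\<sigma> u v. M \<le> length \<sigma> \<and> u \<in> K \<and> v \<in> K \<longrightarrow>
        dist (word_map w \<sigma> u) (word_map w \<sigma> v) < d"
      by (rule cells_small[OF d(1)])
    define n where "n = max M N"
    have "cmod (f (g 0) - f (g 1)) \<le> (1 + e) * (L 1 - L 0) + 2 * e"
    proof (rule curve_bound[of "1 + e" n f e])
      show "\<forall>\<sigma>\<in>words n. \<forall>u\<in>word_map w \<sigma> ` K. \<forall>v\<in>word_map w \<sigma> ` K. cmod (f u - f v) \<le> e"
      proof (intro ballI)
        fix \<sigma> u v assume uv: "\<sigma> \<in> words n" "u \<in> word_map w \<sigma> ` K" "v \<in> word_map w \<sigma> ` K"
        then have "u \<in> K" "v \<in> K" using word_map_in_K by auto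
        moreover have "dist u v < d" using uv M by (auto simp: n_def words_def)
        ultimately show "cmod (f u - f v) \<le> e" using d(2)[of v u] by (simp add: dist_norm)
      qed
      show "\<forall>\<sigma>\<in>words n. \<forall>x\<in>word_map w \<sigma> ` ess_fixed_points w.
        \<forall>y\<in>word_map w \<sigma> ` ess_fixed_points w. cmod (f x - f y) \<le> (1 + e) * dist x y"
        using N by (simp add: n_def words_def)
    qed (use e g' L(1) in auto)
    also have "(1 + e) * (L 1 - L 0) \<le> (1 + e) * ?l" using L(2) e by (intro mult_left_mono) auto
    finally show ?thesis using g'(4,5) by simp
  qed
  have "cmod (f x - f y) \<le> ?l"
  proof (rule field_le_epsilon)
    fix r :: real assume r: "r > 0"
    have l: "0 \<le> ?l" by simp
    \<comment> \<open>With \<open>e = r / (?l + 2)\<close> the total error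
      \<open>e * ?l + 2 * e\<close> equals \<open>r\<close>.\<close>
    have "cmod (f x - f y) \<le> (1 + r / (?l + 2)) * ?l + 2 * (r / (?l + 2))"
      using r l by (intro bound divide_pos_pos) linarith+
    also have "\<dots> = ?l + r / (?l + 2) * (?l + 2)"
      by (simp add: algebra_simps add_divide_distrib)
    also have "?l + 2 \<noteq> 0" using l by linarith
    then have "?l + r / (?l + 2) * (?l + 2) = ?l + r" by simp
    finally show "cmod (f x - f y) \<le> ?l + r" .
  qed
  then have "ennreal (cmod (f x - f y)) \<le> ennreal ?l" by (rule ennreal_leI)
  also have "\<dots> = curve_length g" using g'(3) by simp
  finally show ?thesis .
qed

end

section \<open>The commutator with the Dirac operator\<close>

text \<open>The order of the two values comes from \<open>D\<close> reading the reversed edge: in D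
  f x the function is evaluated at the second end of the edge, in f D x at the first.\<close>

definition diff_quot :: "('k \<Rightarrow> 'a::metric_space \<Rightarrow> 'a) \<Rightarrow> real \<Rightarrow> ('a \<Rightarrow> complex) \<Rightarrow> ('k, 'a) index \<Rightarrow> complex" where
  "diff_quot w lam f = (\<lambda>(\<sigma>, e). of_real (1 / (lam ^ length \<sigma> * edge_length e)) *
     (f (word_map w \<sigma> (snd e)) - f (word_map w \<sigma> (fst e))))"

definition reverse_edge :: "('k, 'a) index \<Rightarrow> ('k, 'a) index" where
  "reverse_edge = (\<lambda>(\<sigma>, e). (\<sigma>, prod.swap e))"

lemma reverse_edge_pair [simp]: "reverse_edge (\<sigma>, e) = (\<sigma>, prod.swap e)"
  by (simp add: reverse_edge_def)

lemma edge_length_swap [simp]: "edge_length (prod.swap e) = edge_length e"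
  by (simp add: edge_length_def dist_commute)

lemma bij_reverse_edge: "bij reverse_edge"
  by (rule involuntory_imp_bij) (auto simp: reverse_edge_def)

sublocale fractal \<subseteq> permuted_index "UNIV \<times> edges0 w" "reverse_edge :: ('k, 'a) index \<Rightarrow> _"
proof
  show "bij (reverse_edge :: ('k, 'a) index \<Rightarrow> _)" by (rule bij_reverse_edge)
  show "reverse_edge i \<in> UNIV \<times> edges0 w \<longleftrightarrow> i \<in> UNIV \<times> edges0 w" for i :: "('k, 'a) index"
    by (cases i) (auto simp: edges0_def)
qed

context fractal
begin

lemma cmod_diff_quot:
  assumes "p \<noteq> q"
  shows "cmod (diff_quot w lam f (\<sigma>, p, q)) * dist (word_map w \<sigma> p) (word_map w \<sigma> q) =
    cmod (f (word_map w \<sigma> p) - f (word_map w \<sigma> q))"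
  using assms lam
  by (simp add: diff_quot_def edge_length_def dist_word_map norm_mult norm_divide norm_power
      norm_minus_commute)

section \<open>The representation and the Dirac operator in coordinates\<close>

lemma coord_off_edges:
  "x \<in> triple_space w \<Longrightarrow> e \<notin> edges0 w \<Longrightarrow> coord x (\<sigma>, e) = 0"
  by (cases e) (simp add: triple_space_def ell2_on_def)

lemma triple_spaceI:
  "(\<And>\<sigma> e. e \<notin> edges0 w \<Longrightarrow> coord x (\<sigma>, e) = 0) \<Longrightarrow> x \<in> triple_space w"
  by (simp add: triple_space_def ell2_on_def)

lemma bounded_on_K:
  assumes "continuous_on K f"
  obtains A where "0 \<le> A" "\<forall>x\<in>K. cmod (f x :: complex) \<le> A"
proof -
  have "bounded (f ` K)"
    using assms compact_K by (intro compact_imp_bounded compact_continuous_image)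
  then obtain A where "\<forall>x\<in>f ` K. norm x \<le> A" unfolding bounded_iff by blast
  then show thesis using that[of "\<bar>A\<bar>"] by fastforce
qed

text \<open>\<open>f\<close> is bounded only on \<open>K\<close>. This suffices for
  square-summability, since coordinates off the edges vanish and all cell vertices lie in
  \<open>K\<close>.\<close>

lemma coord_rep:
  assumes f: "continuous_on K f" and x: "x \<in> triple_space w"
  shows "coord (rep w f x) (\<sigma>, e) = f (word_map w \<sigma> (fst e)) * coord x (\<sigma>, e)"
proof -
  obtain A where A: "0 \<le> A" "\<forall>x\<in>K. cmod (f x) \<le> A" by (rule bounded_on_K[OF f])
  have "square_summable (\<lambda>(\<sigma>, e). f (word_map w \<sigma> (fst e)) * coord x (\<sigma>, e))"
  proof (rule square_summable_dominated[OF bij_id, of _ A x])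
    fix i :: "('k, 'a) index"
    obtain \<sigma> e where i: "i = (\<sigma>, e)" by (cases i)
    show "cmod ((\<lambda>(\<sigma>, e). f (word_map w \<sigma> (fst e)) * coord x (\<sigma>, e)) i) \<le> A * cmod (coord x (id i))"
    proof (cases "e \<in> edges0 w")
      case True
      then have "word_map w \<sigma> (fst e) \<in> K"
        using ess_in_K word_map_in_K by (auto simp: edges0_def)
      then have "cmod (f (word_map w \<sigma> (fst e))) \<le> A" using A(2) by blast
      then show ?thesis by (simp add: i norm_mult mult_right_mono)
    next
      case False
      then have "coord x (\<sigma>, e) = 0" using x by (simp add: coord_off_edges)
      then show ?thesis by (simp add: i)
    qed
  qed
  then show ?thesis by (simp add: rep_def coord_Abs_ell2)
qed

lemma rep_in_triple_space:
  assumes f: "continuous_on K f" and x: "x \<in> triple_space w"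
  shows "rep w f x \<in> triple_space w"
  using x by (intro triple_spaceI) (simp add: coord_rep[OF f x] coord_off_edges)

lemma coord_dirac:
  "x \<in> dirac_domain w lam \<Longrightarrow> coord (dirac lam x) = dirac_coord lam x"
  by (simp add: dirac_def dirac_domain_def coord_Abs_ell2)

lemma dirac_in_triple_space:
  assumes "x \<in> dirac_domain w lam" shows "dirac lam x \<in> triple_space w"
proof (rule triple_spaceI)
  fix \<sigma> e assume "e \<notin> edges0 w"
  then have "prod.swap e \<notin> edges0 w" by (auto simp: edges0_def)
  moreover have "x \<in> triple_space w" using assms by (simp add: dirac_domain_def)
  ultimately show "coord (dirac lam x) (\<sigma>, e) = 0"
    by (simp add: coord_dirac[OF assms] dirac_coord_def coord_off_edges)
qed

text \<open>The coordinates of D f x are those of D x times values of \<open>f\<close> on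
  \<open>K\<close>, so the domain of \<open>D\<close> is preserved by every \<open>f\<close>
  continuous on \<open>K\<close>.\<close>

lemma rep_dirac_domain:
  assumes f: "continuous_on K f" and x: "x \<in> dirac_domain w lam"
  shows "rep w f x \<in> dirac_domain w lam"
proof -
  obtain A where A: "0 \<le> A" "\<forall>x\<in>K. cmod (f x) \<le> A" by (rule bounded_on_K[OF f])
  have xH: "x \<in> triple_space w" using x by (simp add: dirac_domain_def)
  have "square_summable (dirac_coord lam (rep w f x))"
  proof (rule square_summable_dominated[OF bij_id, of _ A "dirac lam x"])
    fix i :: "('k, 'a) index"
    obtain \<sigma> e where i: "i = (\<sigma>, e)" by (cases i)
    have eq: "dirac_coord lam (rep w f x) i = f (word_map w \<sigma> (snd e)) * dirac_coord lam x i"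
      by (simp add: dirac_coord_def i coord_rep[OF f xH])
    show "cmod (dirac_coord lam (rep w f x) i) \<le> A * cmod (coord (dirac lam x) (id i))"
    proof (cases "e \<in> edges0 w")
      case True
      then have "word_map w \<sigma> (snd e) \<in> K"
        using ess_in_K word_map_in_K by (auto simp: edges0_def)
      then have "cmod (f (word_map w \<sigma> (snd e))) \<le> A" using A(2) by blast
      then show ?thesis by (simp add: eq coord_dirac[OF x] norm_mult mult_right_mono)
    next
      case False
      then have "coord (dirac lam x) i = 0"
        using dirac_in_triple_space[OF x] by (simp add: i coord_off_edges)
      then show ?thesis by (simp add: eq coord_dirac[OF x])
    qed
  qed
  then show ?thesis using rep_in_triple_space[OF f xH] by (simp add: dirac_domain_def)
qed

lemma coord_commutator:
  assumes f: "continuous_on K f" and x: "x \<in> dirac_domain w lam"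
  shows "coord (dirac lam (rep w f x) - rep w f (dirac lam x)) i =
    diff_quot w lam f i * coord x (reverse_edge i)"
proof -
  obtain \<sigma> e where i: "i = (\<sigma>, e)" by (cases i)
  have xH: "x \<in> triple_space w" using x by (simp add: dirac_domain_def)
  show ?thesis
    by (simp add: i minus_ell2.rep_eq coord_rep[OF f dirac_in_triple_space[OF x]]
        coord_dirac[OF x] coord_dirac[OF rep_dirac_domain[OF f x]] dirac_coord_def
        coord_rep[OF f xH] diff_quot_def algebra_simps)
qed

lemma finite_support_dirac_domain:
  assumes F: "finite F" and x: "x \<in> triple_space w" "x \<in> ell2_on F"
  shows "x \<in> dirac_domain w lam"
proof -
  have "square_summable (dirac_coord lam x)"
  proof (rule square_summable_finite_support)
    show "finite (reverse_edge ` F)" using F by simp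
    fix i assume i: "i \<notin> reverse_edge ` F"
    have "reverse_edge i \<notin> F"
    proof
      assume "reverse_edge i \<in> F"
      then have "reverse_edge (reverse_edge i) \<in> reverse_edge ` F" by blast
      then show False using i by (cases i) simp
    qed
    then have "coord x (reverse_edge i) = 0" using x(2) unfolding ell2_on_def by blast
    then show "dirac_coord lam x i = 0" by (cases i) (simp add: dirac_coord_def)
  qed
  then show ?thesis using x(1) by (simp add: dirac_domain_def)
qed

text \<open>Existence and uniqueness of the bounded extension at once, which gives the
  \<open>THE\<close> in \<open>commutator\<close> its value. Uniqueness holds because the domain of
  \<open>D\<close> contains all finitely supported vectors of the space.\<close>

lemma extends_commutator_iff:
  assumes f: "continuous_on K f"
    and B: "\<forall>i\<in>UNIV \<times> edges0 w. cmod (diff_quot w lam f i) \<le> B"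
  shows "extends_commutator w lam f T \<longleftrightarrow>
    T = weighted_perm (UNIV \<times> edges0 w) (diff_quot w lam f) reverse_edge"
proof
  assume T: "extends_commutator w lam f T"
  have Tb: "T \<in> bounded_ops (ell2_on (UNIV \<times> edges0 w))"
    using T unfolding extends_commutator_def triple_space_def by (elim conjE)
  have fin: "coord (T x) i = diff_quot w lam f i * coord x (reverse_edge i)"
    if "finite F" "x \<in> ell2_on (UNIV \<times> edges0 w)" "x \<in> ell2_on F" for x F i
  proof -
    have x: "x \<in> dirac_domain w lam"
      using finite_support_dirac_domain[OF that(1) _ that(3)] that(2) by (simp add: triple_space_def)
    then have "T x = dirac lam (rep w f x) - rep w f (dirac lam x)"
      using T by (simp add: extends_commutator_def)
    then show ?thesis by (simp add: coord_commutator[OF f x])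
  qed
  show "T = weighted_perm (UNIV \<times> edges0 w) (diff_quot w lam f) reverse_edge"
    by (rule eq_weighted_permI[OF Tb B fin])
next
  let ?W = "weighted_perm (UNIV \<times> edges0 w) (diff_quot w lam f) reverse_edge"
  assume T: "T = ?W"
  have "?W x = dirac lam (rep w f x) - rep w f (dirac lam x)" if x: "x \<in> dirac_domain w lam" for x
  proof (rule coord_eqI)
    fix i
    have "x \<in> ell2_on (UNIV \<times> edges0 w)" using x by (simp add: dirac_domain_def triple_space_def)
    then show "coord (?W x) i = coord (dirac lam (rep w f x) - rep w f (dirac lam x)) i"
      by (simp add: coord_commutator[OF f x] coord_weighted_perm[OF B])
  qed
  then show "extends_commutator w lam f T"
    unfolding extends_commutator_def T
    using weighted_perm_bounded[OF B] rep_dirac_domain[OF f] by (simp add: triple_space_def)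
qed

lemma L_ess_eq:
  assumes "continuous_on K f" "\<forall>i\<in>UNIV \<times> edges0 w. cmod (diff_quot w lam f i) \<le> B"
  shows "L_ess w lam f =
    ess_norm (ell2_on (UNIV \<times> edges0 w))
      (weighted_perm (UNIV \<times> edges0 w) (diff_quot w lam f) reverse_edge)"
  unfolding L_ess_def commutator_def extends_commutator_iff[OF assms] triple_space_def by simp

text \<open>Applied to the basis vector of the reversed edge, the extension shows the weight as one
  of its coordinates.\<close>

lemma triple_algebra_diff_quot_bounded:
  assumes "f \<in> triple_algebra w lam K"
  obtains B where "\<forall>i\<in>UNIV \<times> edges0 w. cmod (diff_quot w lam f i) \<le> B"
proof -
  have f: "continuous_on K f" using assms by (simp add: triple_algebra_def)
  obtain T where T: "extends_commutator w lam f T" using assms by (auto simp: triple_algebra_def)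
  have "T \<in> bounded_ops (triple_space w)"
    using T unfolding extends_commutator_def by (elim conjE)
  then obtain B where B: "\<And>x. x \<in> triple_space w \<Longrightarrow> norm (T x) \<le> B * norm x"
    using bounded_ops_bound by blast
  have "cmod (diff_quot w lam f i) \<le> B" if "i \<in> UNIV \<times> edges0 w" for i
  proof -
    let ?u = "unit_vec (reverse_edge i)"
    have u: "?u \<in> triple_space w" "?u \<in> ell2_on {reverse_edge i}"
      using perm_iff that by (auto simp: triple_space_def ell2_on_def coord_unit_vec)
    then have dom: "?u \<in> dirac_domain w lam"
      by (intro finite_support_dirac_domain[of "{reverse_edge i}"]) simp_all
    then have "T ?u = dirac lam (rep w f ?u) - rep w f (dirac lam ?u)"
      using T by (simp add: extends_commutator_def)
    then have "diff_quot w lam f i = coord (T ?u) i"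
      by (simp add: coord_commutator[OF f dom] coord_unit_vec)
    also have "cmod \<dots> \<le> B"
      using cmod_coord_le_norm[of "T ?u" i] B[OF u(1)] by (simp add: norm_unit_vec)
    finally show ?thesis .
  qed
  then show thesis using that by blast
qed

lemma asymptotically_lipschitz_if_L_ess_le:
  assumes f: "f \<in> triple_algebra w lam K" and L: "L_ess w lam f \<le> 1" and e: "0 < e"
  shows "\<exists>n. \<forall>\<sigma> p q. n \<le> length \<sigma> \<longrightarrow> p \<in> ess_fixed_points w \<longrightarrow> q \<in> ess_fixed_points w \<longrightarrow>
    cmod (f (word_map w \<sigma> p) - f (word_map w \<sigma> q)) \<le>
      (1 + e) * dist (word_map w \<sigma> p) (word_map w \<sigma> q)"
proof -
  obtain B where B: "\<forall>i\<in>UNIV \<times> edges0 w. cmod (diff_quot w lam f i) \<le> B"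
    by (rule triple_algebra_diff_quot_bounded[OF f])
  have cont: "continuous_on K f" using f by (simp add: triple_algebra_def)
  let ?S = "{i \<in> UNIV \<times> edges0 w. 1 + e \<le> cmod (diff_quot w lam f i)}"
  have fin: "finite ?S"
    using L e by (intro finite_weights_above_ess_norm[OF B]) (simp add: L_ess_eq[OF cont B])
  \<comment> \<open>One more than the longest word carrying a large difference quotient; the
    inserted 0 covers the case that there is none.\<close>
  define n where "n = Suc (Max (insert 0 ((length \<circ> fst) ` ?S)))"
  have "cmod (f (word_map w \<sigma> p) - f (word_map w \<sigma> q)) \<le>
      (1 + e) * dist (word_map w \<sigma> p) (word_map w \<sigma> q)"
    if *: "n \<le> length \<sigma>" "p \<in> ess_fixed_points w" "q \<in> ess_fixed_points w" for \<sigma> p q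
  proof (cases "p = q")
    case False
    have "(\<sigma>, p, q) \<notin> ?S"
    proof
      assume "(\<sigma>, p, q) \<in> ?S"
      then have "length \<sigma> \<in> (length \<circ> fst) ` ?S" by (force simp: image_iff)
      then have "length \<sigma> \<le> Max (insert 0 ((length \<circ> fst) ` ?S))" using fin by (intro Max_ge) auto
      then show False using *(1) by (simp add: n_def)
    qed
    then have "cmod (diff_quot w lam f (\<sigma>, p, q)) \<le> 1 + e"
      using * False by (auto simp: edges0_def)
    then show ?thesis
      unfolding cmod_diff_quot[OF False, symmetric] by (intro mult_right_mono) auto
  qed simp
  then show ?thesis by blast
qed

lemma L_ess_le_if_lipschitz_on_small_edges:
  assumes f: "continuous_on K f"
    and lip: "\<forall>\<sigma> p q. n \<le> length \<sigma> \<longrightarrow> p \<in> ess_fixed_points w \<longrightarrow> q \<in> ess_fixed_points w \<longrightarrow>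
      cmod (f (word_map w \<sigma> p) - f (word_map w \<sigma> q)) \<le> dist (word_map w \<sigma> p) (word_map w \<sigma> q)"
  shows "f \<in> triple_algebra w lam K" "L_ess w lam f \<le> 1"
proof -
  let ?m = "diff_quot w lam f"
  \<comment> \<open>The finitely many indices of levels below \<open>n\<close>, where nothing is
    known about the difference quotients; a compact operator removes them.\<close>
  define F where "F = (\<Union>k<n. words k :: 'k list set) \<times> edges0 w"
  have F: "finite F" unfolding F_def by (simp add: finite_words finite_edges0)
  have le1: "\<forall>i\<in>UNIV \<times> edges0 w - F. cmod (?m i) \<le> 1"
  proof
    fix i assume i: "i \<in> UNIV \<times> edges0 w - F"
    obtain \<sigma> p q where ipq: "i = (\<sigma>, p, q)" by (cases i)
    have pq: "p \<in> ess_fixed_points w" "q \<in> ess_fixed_points w" "p \<noteq> q" "n \<le> length \<sigma>"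
      using i by (auto simp: ipq edges0_def F_def words_def)
    have "0 < dist (word_map w \<sigma> p) (word_map w \<sigma> q)"
      using pq(3) lam by (simp add: dist_word_map)
    moreover have "cmod (?m i) * dist (word_map w \<sigma> p) (word_map w \<sigma> q)
        \<le> 1 * dist (word_map w \<sigma> p) (word_map w \<sigma> q)"
      using lip pq by (simp add: ipq cmod_diff_quot[OF pq(3)])
    ultimately show "cmod (?m i) \<le> 1" by (simp only: mult_le_cancel_right_pos)
  qed
  define B where "B = Max (insert 1 ((cmod \<circ> ?m) ` F))"
  have B: "\<forall>i\<in>UNIV \<times> edges0 w. cmod (?m i) \<le> B"
  proof
    fix i :: "('k, 'a) index" assume i: "i \<in> UNIV \<times> edges0 w"
    show "cmod (?m i) \<le> B"
    proof (cases "i \<in> F")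
      case True
      then show ?thesis unfolding B_def using F by (intro Max_ge) auto
    next
      case False
      then have "cmod (?m i) \<le> 1" using le1 i by blast
      also have "1 \<le> B" unfolding B_def using F by (intro Max_ge) auto
      finally show ?thesis .
    qed
  qed
  show "f \<in> triple_algebra w lam K"
    using f extends_commutator_iff[OF f B] by (auto simp: triple_algebra_def)
  show "L_ess w lam f \<le> 1"
    unfolding L_ess_eq[OF f B] by (rule ess_norm_weighted_perm_le[OF B F _ le1]) simp
qed

section \<open>The two inequalities between the distances\<close>

lemma d_ess_le_d_geo: "d_ess w lam K x y \<le> d_geo K x y"
  unfolding d_ess_def d_geo_def
proof (intro SUP_least INF_greatest)
  fix f g assume f: "f \<in> {f \<in> triple_algebra w lam K. L_ess w lam f \<le> 1}"
    and g: "g \<in> rectifiable_curves K x y"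
  show "ennreal (cmod (f x - f y)) \<le> curve_length g"
  proof (rule asymptotic_lipschitz_imp_le_length[OF _ _ g])
    show "continuous_on K f" using f by (simp add: triple_algebra_def)
  qed (use f asymptotically_lipschitz_if_L_ess_le in blast)
qed

text \<open>The test function is d_e(x, .), which vanishes at \<open>x\<close>. Cells of deep levels
  have diameter at most \<open>e\<close>, so it is 1-Lipschitz along their edges.\<close>

lemma chain_dist_le_d_ess:
  assumes K: "connected K" and e: "0 < e" and x: "x \<in> K" and y: "y \<in> K"
  shows "ennreal (chain_dist K e x y) \<le> d_ess w lam K x y"
proof -
  define f where "f z = complex_of_real (chain_dist K e x z)" for z
  have f: "continuous_on K f"
    unfolding f_def using continuous_on_chain_dist[OF K e x] by (intro continuous_on_of_real)
  obtain n where n: "\<forall>\<sigma> u v. n \<le> length \<sigma> \<and> u \<in> K \<and> v \<in> K \<longrightarrow>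
      dist (word_map w \<sigma> u) (word_map w \<sigma> v) < e"
    by (rule cells_small[OF e])
  have "cmod (f (word_map w \<sigma> p) - f (word_map w \<sigma> q)) \<le> dist (word_map w \<sigma> p) (word_map w \<sigma> q)"
    if "n \<le> length \<sigma>" "p \<in> ess_fixed_points w" "q \<in> ess_fixed_points w" for \<sigma> p q
  proof -
    have pq: "p \<in> K" "q \<in> K" using that ess_in_K by auto
    then have "dist (word_map w \<sigma> p) (word_map w \<sigma> q) \<le> e" using n that(1) less_imp_le by blast
    then have "\<bar>chain_dist K e x (word_map w \<sigma> p) - chain_dist K e x (word_map w \<sigma> q)\<bar>
        \<le> dist (word_map w \<sigma> p) (word_map w \<sigma> q)"
      using pq by (intro chain_dist_local_lipschitz[OF K e x] word_map_in_K)
    then show ?thesis unfolding f_def of_real_diff[symmetric] norm_of_real .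
  qed
  then have lip: "\<forall>\<sigma> p q. n \<le> length \<sigma> \<longrightarrow> p \<in> ess_fixed_points w \<longrightarrow> q \<in> ess_fixed_points w \<longrightarrow>
      cmod (f (word_map w \<sigma> p) - f (word_map w \<sigma> q)) \<le> dist (word_map w \<sigma> p) (word_map w \<sigma> q)"
    by blast
  have "f \<in> {f \<in> triple_algebra w lam K. L_ess w lam f \<le> 1}"
    using L_ess_le_if_lipschitz_on_small_edges[OF f lip] by simp
  then have "ennreal (cmod (f x - f y)) \<le> d_ess w lam K x y"
    unfolding d_ess_def by (rule SUP_upper)
  moreover have "cmod (f x - f y) = chain_dist K e x y"
    using chain_dist_nonneg[OF K e x y] chain_dist_self[OF x] by (simp add: f_def)
  ultimately show ?thesis by simp
qed

text \<open>Finiteness provides a real bound \<open>?M\<close>. The chain distances at all scales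
  are at most \<open>?M\<close>, so for every \<open>e > 0\<close> some chain has length at most
  \<open>?M + e\<close>, and such chains yield a curve of length at most \<open>?M\<close>.\<close>

lemma d_geo_le_d_ess:
  assumes K: "connected K" and x: "x \<in> K" and y: "y \<in> K" and fin: "d_ess w lam K x y < \<infinity>"
  shows "d_geo K x y \<le> d_ess w lam K x y"
proof -
  let ?M = "enn2real (d_ess w lam K x y)"
  have M: "ennreal ?M = d_ess w lam K x y" using fin by simp
  have "\<exists>l. chain K e x y l \<and> l \<le> ?M + e" if e: "e > 0" for e
  proof -
    have "ennreal (chain_dist K e x y) \<le> ennreal ?M"
      unfolding M by (rule chain_dist_le_d_ess[OF K e x y])
    then have "chain_dist K e x y \<le> ?M" by (simp add: ennreal_le_iff)
    then have less: "Inf {l. chain K e x y l} < ?M + e" using e by (simp add: chain_dist_def)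
    have "{l. chain K e x y l} \<noteq> {}" using chain_exists[OF K e x y] by blast
    from cInf_lessD[OF this less] show ?thesis by (auto intro: less_imp_le)
  qed
  then have "\<forall>e>0. \<exists>l. chain K e x y l \<and> l \<le> ?M + e" by blast
  then have "d_geo K x y \<le> ennreal ?M"
    by (intro d_geo_le_if_chains[OF compact_K]) simp
  then show ?thesis unfolding M .
qed

end

theorem theorem4p2:
  fixes w :: "'k::finite \<Rightarrow> 'a::euclidean_space \<Rightarrow> 'a" and lam :: real and K :: "'a set"
  assumes "nested_fractal w lam K"
    and "finitely_arcwise_connected K"
  shows "\<forall>x\<in>K. \<forall>y\<in>K. d_ess w lam K x y < \<infinity> \<and> d_ess w lam K x y = d_geo K x y"
proof (intro ballI)
  fix x y assume x: "x \<in> K" and y: "y \<in> K"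
  interpret fractal w lam K using assms(1) by unfold_locales
  have ex: "\<exists>g. g \<in> rectifiable_curves K x y" if "x \<in> K" "y \<in> K" for x y
    using assms(2) that unfolding finitely_arcwise_connected_def by blast
  \<comment> \<open>Rectifiable curves are paths; the connectedness obtained is what makes chains of
    every step size exist.\<close>
  have "path_connected K"
    unfolding path_connected_def using ex by (fastforce simp: rectifiable_curves_def)
  then have conn: "connected K" by (rule path_connected_imp_connected)
  obtain g where g: "g \<in> rectifiable_curves K x y" using ex[OF x y] by blast
  then have "d_geo K x y \<le> curve_length g" unfolding d_geo_def by (rule INF_lower)
  then have "d_geo K x y < \<infinity>" using g by (auto simp: rectifiable_curves_def)
  \<comment> \<open>A single rectifiable curve bounds \<open>d_geo\<close> and thereby
    \<open>d_ess\<close>; this finiteness must precede the converse inequality.\<close>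
  then have fin: "d_ess w lam K x y < \<infinity>" using d_ess_le_d_geo le_less_trans by blast
  then show "d_ess w lam K x y < \<infinity> \<and> d_ess w lam K x y = d_geo K x y"
    using d_ess_le_d_geo d_geo_le_d_ess[OF conn x y fin] by (simp add: antisym)
qed

end
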